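(* Let $D$ be a bounded, hyperconvex domain in $\mathbb C$ and let $n\geq 2$. Assume that $c_{S_n(D)}\equiv l_{S_n(D)}$. Then $D$ is biholomorphic to $\mathbb D$ and $n=2$.
   Context: $\mathbb D$ is the open unit disc in $\mathbb C$ and $p$ is the Poincaré distance on $\mathbb D$ (so $p(0,\sigma)=\operatorname{artanh}|\sigma|$). $\pi_n:\mathbb C^n\to\mathbb C^n$ is the symmetrization map, $\pi_n(\lambda_1,\ldots,\lambda_n)=(\sigma_1(\lambda),\ldots,\sigma_n(\lambda))$, where $\sigma_j$ is the $j$-th elementary symmetric polynomial. For a domain $D\subset\mathbb C$, $S_n(D):=\pi_n(D^n)$, which is a domain in $\mathbb C^n$. For a domain $\Omega\subset\mathbb C^n$: the Carathéodory pseudodistance is $c_\Omega(w,z)=\sup\{p(0,F(z)):F\in\mathcal O(\Omega,\mathbb D),\ F(w)=0\}$, and the Lempert function is $$l_\Omega(w,z)=\inf\{p(0,\sigma):\sigma\in\mathbb D,\ \exists f\in\mathcal O(\mathbb D,\Omega)\text{ such that } f(0)=w,\ f(\sigma)=z\}.$$ A domain is hyperconvex if it admits a negative plurisubharmonic (in $\mathbb C$: subharmonic) exhaustion function, i.e. a plurisubharmonic $u:\Omega\to(-\infty,0)$ such that $\{z\in\Omega:u(z)<t\}$ is relatively compact in $\Omega$ for every $t<0$. *)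

theory Defs
  imports "HOL-Complex_Analysis.Complex_Analysis"
begin

definition is_domain :: "'a::topological_space set \<Rightarrow> bool" where
  "is_domain \<Omega> \<longleftrightarrow> open \<Omega> \<and> connected \<Omega> \<and> \<Omega> \<noteq> {}"

definition poincare_dist :: "complex \<Rightarrow> complex \<Rightarrow> real" where
  "poincare_dist a b = artanh (cmod ((a - b) / (1 - cnj a * b)))"

lemma poincare_dist_0: "poincare_dist 0 \<sigma> = artanh (cmod \<sigma>)"
  by (simp add: poincare_dist_def)

text \<open>Holomorphy in several variables is complex Frechet differentiability: the derivative of
  the real-normed-space library notion is required to be complex linear.\<close>

definition holo_scalar :: "(complex ^ 'n \<Rightarrow> complex) \<Rightarrow> (complex ^ 'n) set \<Rightarrow> bool" where
  "holo_scalar F \<Omega> \<longleftrightarrow>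
     (\<forall>z\<in>\<Omega>. \<exists>F'. (F has_derivative F') (at z within \<Omega>) \<and> Vector_Spaces.linear (*s) (*) F')"

definition holo_disc :: "(complex \<Rightarrow> complex ^ 'n) \<Rightarrow> complex set \<Rightarrow> bool" where
  "holo_disc f U \<longleftrightarrow> (\<forall>i. (\<lambda>\<zeta>. f \<zeta> $ i) holomorphic_on U)"

definition elem_sym :: "nat \<Rightarrow> complex ^ 'n \<Rightarrow> complex" where
  "elem_sym k x = (\<Sum>S | card S = k. \<Prod>i\<in>S. x $ i)"

text \<open>The linear order on the index type numbers the coordinates: \<^term>\<open>card {..i}\<close> runs
  through \<open>1, \<dots>, n\<close> as \<open>i\<close> runs through the index type in increasing order.\<close>

definition symmetrization :: "complex ^ ('n::{finite,linorder}) \<Rightarrow> complex ^ ('n::{finite,linorder})" where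
  "symmetrization x = (\<chi> i. elem_sym (card {..i}) x)"

definition symmetric_power :: "complex set \<Rightarrow> (complex ^ ('n::{finite,linorder})) set" where
  "symmetric_power D = symmetrization ` {x. \<forall>i. x $ i \<in> D}"

text \<open>Both functions take values in \<^typ>\<open>ereal\<close>, so that the supremum of an unbounded set and the
  infimum of the empty set are infinite.\<close>

definition caratheodory :: "(complex ^ 'n) set \<Rightarrow> complex ^ 'n \<Rightarrow> complex ^ 'n \<Rightarrow> ereal" where
  "caratheodory \<Omega> w z =
     Sup {ereal (poincare_dist 0 (F z)) | F.
            holo_scalar F \<Omega> \<and> F ` \<Omega> \<subseteq> ball 0 1 \<and> F w = 0}"

definition lempert :: "(complex ^ 'n) set \<Rightarrow> complex ^ 'n \<Rightarrow> complex ^ 'n \<Rightarrow> ereal" where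
  "lempert \<Omega> w z =
     Inf {ereal (poincare_dist 0 \<sigma>) | \<sigma>. \<sigma> \<in> ball 0 1 \<and>
            (\<exists>f. holo_disc f (ball 0 1) \<and> f ` ball 0 1 \<subseteq> \<Omega> \<and> f 0 = w \<and> f \<sigma> = z)}"

text \<open>Real-valued subharmonic functions: upper semicontinuity and the sub-mean value inequality
  on every closed disc in the set. Integrability over the circle is automatic for a finite-valued
  subharmonic function; it is stated because the integral of a non-integrable function is
  \<open>0\<close> by convention.\<close>

definition subharmonic_on :: "(complex \<Rightarrow> real) \<Rightarrow> complex set \<Rightarrow> bool" where
  "subharmonic_on u D \<longleftrightarrow>
     (\<forall>t. openin (top_of_set D) {z \<in> D. u z < t}) \<and>
     (\<forall>a r. 0 < r \<longrightarrow> cball a r \<subseteq> D \<longrightarrow>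
        set_integrable lborel {0..2 * pi} (\<lambda>\<theta>. u (a + of_real r * cis \<theta>)) \<and>
        u a \<le> (LINT \<theta>:{0..2 * pi}|lborel. u (a + of_real r * cis \<theta>)) / (2 * pi))"

definition hyperconvex :: "complex set \<Rightarrow> bool" where
  "hyperconvex D \<longleftrightarrow>
     (\<exists>u. subharmonic_on u D \<and> (\<forall>z\<in>D. u z < 0) \<and>
        (\<forall>t<0. compact (closure {z \<in> D. u z < t}) \<and> closure {z \<in> D. u z < t} \<subseteq> D))"

definition biholomorphic :: "complex set \<Rightarrow> complex set \<Rightarrow> bool" where
  "biholomorphic U V \<longleftrightarrow>
     (\<exists>f g. f holomorphic_on U \<and> g holomorphic_on V \<and> f ` U \<subseteq> V \<and> g ` V \<subseteq> U \<and>
        (\<forall>z\<in>U. g (f z) = z) \<and> (\<forall>w\<in>V. f (g w) = w))"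

end

theory Submission
  imports Defs
begin

text \<open>A disc in the symmetric power of \<open>D\<close> is treated as a multivalued function \<open>l\<close> with \<open>n\<close>
  branches in \<open>D\<close>.

  \<open>D\<close> is a disc: let \<open>g\<close> realise the Caratheodory distance of two nearby points \<open>a\<close>, \<open>b\<close> of \<open>D\<close>, so
  that \<open>g'(a) \<noteq> 0\<close>. By hypothesis, the images of \<open>(a, \<dots>, a)\<close> and \<open>(b, \<dots>, b)\<close> are joined by almost
  extremal discs. The mean of \<open>g\<close> over their branches tends to a rotation \<open>\<alpha>\<zeta>\<close>, so the variance,
  at most \<open>1 - \<bar>\<alpha>\<zeta>\<bar>\<^sup>2\<close> in the limit, dies at the boundary; hence \<open>g\<close> of every branch tends to \<open>\<alpha>\<zeta>\<close>.
  Since \<open>g'(a) \<noteq> 0\<close>, the branches merge into one limit \<open>h\<close>, which stays in \<open>D\<close> by Hurwitz's theorem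
  and inverts \<open>g / \<alpha>\<close>.

  \<open>n \<le> 2\<close>: identify \<open>D\<close> with the disc and compare the \<open>n\<close> roots of \<open>t\<^sup>n = \<epsilon>\<close> with \<open>(1/2, \<dots>, 1/2)\<close>. The
  Caratheodory distance exceeds that of \<open>0\<close> and \<open>1/2\<close> by at most \<open>O(\<epsilon>)\<close>. For a disc joining the two
  points, let \<open>\<phi>\<close> be the mean of the branches and \<open>Q\<close> the product of their deviations from \<open>\<phi>\<close>; then
  \<open>\<bar>Q(0)\<bar> = \<epsilon>\<close>, and \<open>\<bar>Q\<bar>\<close> to the power \<open>2/n\<close> is at most \<open>1 - \<bar>\<phi>\<bar>\<^sup>2\<close> by the inequality of the means.
  By the maximum principle \<open>\<phi>(\<zeta>)/\<zeta>\<close> then has modulus at most \<open>1 - \<epsilon>\<^bsup>2/n\<^esup> / 2\<close> at \<open>0\<close>, so the Lempert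
  function exceeds the distance of \<open>0\<close> and \<open>1/2\<close> by at least a multiple of \<open>\<epsilon>\<^bsup>2/n\<^esup>\<close>, which is larger
  than \<open>O(\<epsilon>)\<close> when \<open>n \<ge> 3\<close>.\<close>

section \<open>Elementary symmetric polynomials\<close>

lemma elem_sym_0 [simp]: "elem_sym 0 x = 1"
  by (simp add: elem_sym_def)

lemma elem_sym_card: "elem_sym CARD('n) (x :: complex ^ 'n) = (\<Prod>i\<in>UNIV. x $ i)"
proof -
  have "{S :: 'n set. card S = CARD('n)} = {UNIV}"
    using card_subset_eq[OF finite subset_UNIV, of _] by auto
  then show ?thesis by (simp add: elem_sym_def)
qed

lemma elem_sym_gt_card: "CARD('n) < k \<Longrightarrow> elem_sym k (x :: complex ^ 'n) = 0"
proof -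
  assume k: "CARD('n) < k"
  have "card S \<noteq> k" for S :: "'n set"
    using card_mono[of UNIV S] k by auto
  then show ?thesis by (simp add: elem_sym_def)
qed

lemma elem_sym_1: "elem_sym 1 (x :: complex ^ 'n) = (\<Sum>i\<in>UNIV. x $ i)"
proof -
  have "{S :: 'n set. card S = 1} = (\<lambda>i. {i}) ` UNIV"
    by (auto simp: card_1_singleton_iff)
  then show ?thesis
    by (simp add: elem_sym_def sum.reindex inj_on_def)
qed

lemma vieta:
  "(\<Prod>i\<in>UNIV. t - (x :: complex ^ 'n) $ i)
    = (\<Sum>k\<le>CARD('n). (-1) ^ k * elem_sym k x * t ^ (CARD('n) - k))"
proof -
  let ?h = "\<lambda>S. (-1) ^ card S * (\<Prod>i\<in>S. x $ i) * t ^ (CARD('n) - card S)"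
  have "(\<Prod>i\<in>UNIV. t - x $ i) = (\<Sum>S\<in>UNIV. ?h S)"
    using prod_diff_conv_sum[of "UNIV :: 'n set" "\<lambda>_. t" "\<lambda>i. x $ i"]
    by (simp add: card_Diff_subset)
  also have "\<dots> = (\<Sum>k\<le>CARD('n). \<Sum>S | S \<in> UNIV \<and> card S = k. ?h S)"
    by (rule sum.group[symmetric]) (auto intro: card_mono)
  also have "\<dots> = (\<Sum>k\<le>CARD('n). (-1) ^ k * elem_sym k x * t ^ (CARD('n) - k))"
    unfolding elem_sym_def by (intro sum.cong refl) (simp add: sum_distrib_left sum_distrib_right)
  finally show ?thesis .
qed

lemma card_atMost_index:
  fixes i :: "'n::{finite,linorder}"
  shows "card {..i} \<in> {1..CARD('n)}"
proof -
  have "{..i} \<noteq> {}" by auto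
  then have "card {..i} > 0" by (simp add: card_gt_0_iff)
  moreover have "card {..i} \<le> CARD('n)" by (intro card_mono) auto
  ultimately show ?thesis by simp
qed

lemma range_card_atMost:
  "range (\<lambda>i :: 'n::{finite,linorder}. card {..i}) = {1..CARD('n)}"
proof (rule card_subset_eq)
  have "inj (\<lambda>i :: 'n. card {..i})"
  proof (rule linorder_injI)
    fix i j :: 'n assume "i < j"
    then have "{..i} \<subset> {..j}" by auto
    then show "card {..i} \<noteq> card {..j}"
      using psubset_card_mono[of "{..j}" "{..i}"] by simp
  qed
  then show "card (range (\<lambda>i :: 'n. card {..i})) = card {1..CARD('n)}"
    by (simp add: card_image)
qed (use card_atMost_index in \<open>auto simp del: atLeastAtMost_iff\<close>)

text \<open>The coordinates of \<open>symmetrization\<close> are the elementary symmetric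
  polynomials of degrees 1 to \<open>CARD('n)\<close>; in every other degree \<open>elem_sym\<close>
  is constant.\<close>

lemma symmetrization_eq_iff:
  fixes x y :: "complex ^ 'n::{finite,linorder}"
  shows "symmetrization x = symmetrization y \<longleftrightarrow> (\<forall>k. elem_sym k x = elem_sym k y)"
proof
  assume eq: "symmetrization x = symmetrization y"
  show "\<forall>k. elem_sym k x = elem_sym k y"
  proof
    fix k
    consider "k = 0" | "k > CARD('n)" | "k \<in> {1..CARD('n)}" by force
    then show "elem_sym k x = elem_sym k y"
    proof cases
      case 3
      then obtain i :: 'n where "k = card {..i}"
        unfolding range_card_atMost[symmetric] by auto
      then show ?thesis
        using arg_cong[OF eq, of "\<lambda>v. v $ i"] by (simp add: symmetrization_def)
    qed (auto simp: elem_sym_gt_card)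
  qed
qed (simp add: symmetrization_def)

text \<open>By Vieta's formulas the monic polynomials with the coordinates as roots coincide, and a
  polynomial determines its roots with multiplicity. A point of the symmetric power thus fixes its
  branches up to order, which the next three lemmas exploit.\<close>

lemma mset_eq_of_elem_sym_eq:
  fixes x y :: "complex ^ 'n"
  assumes "\<And>k. elem_sym k x = elem_sym k y"
  shows "image_mset (($) x) (mset_set UNIV) = image_mset (($) y) (mset_set UNIV)"
proof -
  let ?p = "\<lambda>x :: complex ^ 'n. \<Prod>i\<in>UNIV. [:- (x $ i), 1:]"
  have "poly (?p x) t = poly (?p y) t" for t
    using vieta[of t x] vieta[of t y] assms by (simp add: poly_prod)
  then have "?p x = ?p y" by (simp flip: poly_eq_poly_eq_iff add: fun_eq_iff)
  moreover have "proots (?p x) = image_mset (($) x) (mset_set UNIV)" for x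
    by (subst proots_prod) (auto simp: sum_unfold_sum_mset)
  ultimately show ?thesis by metis
qed

lemma sum_eq_of_elem_sym_eq:
  fixes x y :: "complex ^ 'n"
  assumes "\<And>k. elem_sym k x = elem_sym k y"
  shows "(\<Sum>i\<in>UNIV. G (x $ i)) = (\<Sum>i\<in>UNIV. G (y $ i))"
  using arg_cong[OF mset_eq_of_elem_sym_eq[OF assms], of "\<lambda>M. \<Sum>\<^sub># (image_mset G M)"]
  by (simp add: sum_unfold_sum_mset image_mset.compositionality comp_def)

lemma prod_eq_of_elem_sym_eq:
  fixes x y :: "complex ^ 'n"
  assumes "\<And>k. elem_sym k x = elem_sym k y"
  shows "(\<Prod>i\<in>UNIV. G (x $ i)) = (\<Prod>i\<in>UNIV. G (y $ i))"
  using arg_cong[OF mset_eq_of_elem_sym_eq[OF assms], of "\<lambda>M. \<Prod>\<^sub># (image_mset G M)"]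
  by (simp add: prod_unfold_prod_mset image_mset.compositionality comp_def)

lemma range_eq_of_elem_sym_eq:
  fixes x y :: "complex ^ 'n"
  assumes "\<And>k. elem_sym k x = elem_sym k y"
  shows "range (($) x) = range (($) y)"
  using arg_cong[OF mset_eq_of_elem_sym_eq[OF assms], of set_mset] by simp

text \<open>Vieta's polynomial vanishes at the root \<open>y $ j\<close>, so the power of the root
  is a combination of the terms with \<open>k \<ge> 1\<close>. Small elementary symmetric
  polynomials therefore force small coordinates.\<close>

lemma root_bound:
  fixes y :: "complex ^ 'n"
  assumes M: "M \<ge> 1" "\<And>i. cmod (y $ i) \<le> M"
  shows "cmod (y $ j) ^ CARD('n) \<le> M ^ CARD('n) * (\<Sum>k\<in>{1..CARD('n)}. cmod (elem_sym k y))"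
proof -
  let ?n = "CARD('n)" and ?t = "y $ j"
  have "(\<Prod>i\<in>UNIV. ?t - y $ i) = 0" by (auto intro: prod_zero)
  then have "0 = (\<Sum>k\<le>?n. (-1) ^ k * elem_sym k y * ?t ^ (?n - k))" by (simp add: vieta)
  also have "{..?n} = insert 0 {1..?n}" by auto
  finally have "?t ^ ?n = - (\<Sum>k\<in>{1..?n}. (-1) ^ k * elem_sym k y * ?t ^ (?n - k))"
    by (simp add: eq_neg_iff_add_eq_0)
  from arg_cong[OF this, of cmod]
  have "cmod ?t ^ ?n = cmod (\<Sum>k\<in>{1..?n}. (-1) ^ k * elem_sym k y * ?t ^ (?n - k))"
    unfolding norm_minus_cancel norm_power .
  also have "\<dots> \<le> (\<Sum>k\<in>{1..?n}. cmod (elem_sym k y) * M ^ ?n)"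
  proof (rule order_trans[OF norm_sum], rule sum_mono)
    fix k
    have "cmod ?t ^ (?n - k) \<le> M ^ (?n - k)" using M by (intro power_mono) auto
    also have "\<dots> \<le> M ^ ?n" using M by (intro power_increasing) auto
    finally show "cmod ((-1) ^ k * elem_sym k y * ?t ^ (?n - k)) \<le> cmod (elem_sym k y) * M ^ ?n"
      by (simp add: norm_mult norm_power mult_left_mono)
  qed
  finally show ?thesis by (simp add: sum_distrib_left mult.commute)
qed

text \<open>The mixed sums of Newton's identities: they interpolate between products of power sums and
  elementary symmetric polynomials.\<close>

definition newton_sum :: "nat \<Rightarrow> nat \<Rightarrow> complex ^ 'n \<Rightarrow> complex" where
  "newton_sum k i x = (\<Sum>S | card S = k. \<Sum>j\<in>-S. x $ j ^ i * (\<Prod>l\<in>S. x $ l))"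

text \<open>Double counting: a set with a chosen member corresponds to the set without it and a
  chosen point outside.\<close>

lemma sum_subset_member_swap:
  "(\<Sum>S | card S = Suc k. \<Sum>j\<in>S. h j (S - {j})) = (\<Sum>T | card T = k. \<Sum>j\<in>-T. h j T)"
  for h :: "'n::finite \<Rightarrow> 'n set \<Rightarrow> complex"
proof -
  have "(\<Sum>S | card S = Suc k. \<Sum>j\<in>S. h j (S - {j}))
      = (\<Sum>(S, j)\<in>Sigma {S. card S = Suc k} (\<lambda>S. S). h j (S - {j}))"
    by (subst sum.Sigma) auto
  also have "\<dots> = (\<Sum>(T, j)\<in>Sigma {T. card T = k} uminus. h j T)"
    by (rule sum.reindex_bij_witness[where i = "\<lambda>(T, j). (insert j T, j)"
          and j = "\<lambda>(S, j). (S - {j}, j)"])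
       (auto simp: insert_absorb card_insert_if)
  also have "\<dots> = (\<Sum>T | card T = k. \<Sum>j\<in>-T. h j T)"
    by (subst sum.Sigma) auto
  finally show ?thesis .
qed

lemma newton_sum_1: "newton_sum k 1 x = of_nat (Suc k) * elem_sym (Suc k) x"
proof -
  have "newton_sum k 1 x = (\<Sum>S | card S = Suc k. \<Sum>j\<in>S. x $ j ^ 1 * (\<Prod>l\<in>S - {j}. x $ l))"
    unfolding newton_sum_def by (rule sum_subset_member_swap[symmetric])
  also have "\<dots> = (\<Sum>S | card S = Suc k. \<Sum>j\<in>S. \<Prod>l\<in>S. x $ l)"
    by (intro sum.cong refl) (simp add: prod.remove[symmetric])
  finally show ?thesis by (simp add: elem_sym_def sum_distrib_left)
qed

lemma power_sum_mult_elem_sym: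
  "(\<Sum>j\<in>UNIV. x $ j ^ i) * elem_sym (Suc k) x = newton_sum (Suc k) i x + newton_sum k (Suc i) x"
proof -
  have "newton_sum k (Suc i) x
      = (\<Sum>S | card S = Suc k. \<Sum>j\<in>S. x $ j ^ Suc i * (\<Prod>l\<in>S - {j}. x $ l))"
    unfolding newton_sum_def by (rule sum_subset_member_swap[symmetric])
  also have "\<dots> = (\<Sum>S | card S = Suc k. \<Sum>j\<in>S. x $ j ^ i * (\<Prod>l\<in>S. x $ l))"
    by (intro sum.cong refl) (simp add: prod.remove mult_ac)
  moreover have sum_Compl: "(\<Sum>j\<in>-S. f j) + (\<Sum>j\<in>S. f j) = (\<Sum>j\<in>UNIV. f j)"
    for f :: "'a \<Rightarrow> complex" and S
    by (simp add: sum.subset_diff[of S UNIV f] Compl_eq_Diff_UNIV)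
  ultimately have "newton_sum (Suc k) i x + newton_sum k (Suc i) x
      = (\<Sum>S | card S = Suc k. \<Sum>j\<in>UNIV. x $ j ^ i * (\<Prod>l\<in>S. x $ l))"
    unfolding newton_sum_def
    by (simp add: sum_Compl flip: sum.distrib)
  then show ?thesis
    by (simp add: elem_sym_def sum_distrib_left sum_distrib_right)
qed

text \<open>Newton's identities as an induction on \<open>k\<close>. The claim is carried for
  \<open>newton_sum k i\<close> with all \<open>i \<ge> 1\<close>, because passing to
  \<open>Suc k\<close> calls on the exponent \<open>Suc i\<close>; exponent 1 gives back
  \<open>elem_sym (Suc k)\<close> up to the factor \<open>Suc k\<close>.\<close>

lemma elem_sym_holomorphic_of_power_sums:
  assumes "\<And>i. i \<ge> 1 \<Longrightarrow> (\<lambda>\<zeta>. \<Sum>j\<in>UNIV. (x \<zeta> :: complex ^ 'n) $ j ^ i) holomorphic_on U"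
  shows "(\<lambda>\<zeta>. elem_sym k (x \<zeta>)) holomorphic_on U"
proof -
  have N: "(\<lambda>\<zeta>. newton_sum k i (x \<zeta>)) holomorphic_on U" if "i \<ge> 1" for k i
    using that
  proof (induction k arbitrary: i)
    case 0
    then show ?case using assms by (simp add: newton_sum_def)
  next
    case (Suc k)
    have e: "elem_sym (Suc k) (x \<zeta>) = newton_sum k 1 (x \<zeta>) / of_nat (Suc k)" for \<zeta>
      unfolding newton_sum_1 by (simp del: of_nat_Suc)
    have "(\<lambda>\<zeta>. (\<Sum>j\<in>UNIV. x \<zeta> $ j ^ i) * elem_sym (Suc k) (x \<zeta>) - newton_sum k (Suc i) (x \<zeta>))
        holomorphic_on U"
      unfolding e using Suc.IH[of 1] Suc.IH[of "Suc i"] assms[OF Suc.prems]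
      by (intro holomorphic_on_diff holomorphic_on_mult holomorphic_on_divide holomorphic_on_const)
         (auto simp del: of_nat_Suc)
    then show ?case by (simp add: power_sum_mult_elem_sym)
  qed
  show ?thesis
  proof (cases k)
    case (Suc m)
    have e: "elem_sym (Suc m) (x \<zeta>) = newton_sum m 1 (x \<zeta>) / of_nat (Suc m)" for \<zeta>
      unfolding newton_sum_1 by (simp del: of_nat_Suc)
    show ?thesis
      unfolding Suc e using N[of 1 m]
      by (intro holomorphic_on_divide holomorphic_on_const) (auto simp del: of_nat_Suc)
  qed simp
qed

section \<open>Schwarz-Pick and maximum principles\<close>

text \<open>Schwarz's lemma for \<open>f\<close> followed by the disc automorphism that sends
  \<open>f 0\<close> to 0, with the arguments of the values then forgotten. Modulus 1 is permitted;
  \<open>f\<close> is then constant.\<close>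

lemma schwarz_pick_modulus:
  assumes hol: "f holomorphic_on ball 0 1" and le: "\<And>z. cmod z < 1 \<Longrightarrow> cmod (f z) \<le> 1"
    and z: "cmod z < 1"
  shows "\<bar>cmod (f z) - cmod (f 0)\<bar> \<le> cmod z * (1 - cmod (f z) * cmod (f 0))"
proof (cases "\<exists>z0\<in>ball 0 1. cmod (f z0) = 1")
  case True
  then obtain z0 where z0: "z0 \<in> ball 0 1" "cmod (f z0) = 1" by auto
  have "f constant_on ball 0 1"
    by (rule maximum_modulus_principle[OF hol _ _ _ _ z0(1)]) (use le z0 in auto)
  then have "f z = f 0" using z unfolding constant_on_def by force
  moreover have "cmod (f 0) * cmod (f 0) \<le> 1" using le[of 0] by (simp add: mult_le_one)
  ultimately show ?thesis by (simp add: mult_nonneg_nonneg)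
next
  case False
  then have lt: "cmod (f z) < 1" if "cmod z < 1" for z using le[OF that] that by force
  let ?a = "f 0" and ?b = "f z"
  have nz: "1 - cnj ?a * f w \<noteq> 0" if "cmod w < 1" for w
  proof
    assume "1 - cnj ?a * f w = 0"
    then have "cmod ?a * cmod (f w) = 1" by (metis complex_mod_cnj eq_iff_diff_eq_0 norm_mult norm_one)
    moreover have "cmod ?a * cmod (f w) < 1 * 1"
      using lt[OF that] lt[of 0] by (intro mult_strict_mono') auto
    ultimately show False by simp
  qed
  have "cmod ((\<lambda>w. (f w - ?a) / (1 - cnj ?a * f w)) z) \<le> cmod z"
  proof (rule Schwarz_Lemma(1)[OF _ _ _ z])
    show "(\<lambda>w. (f w - ?a) / (1 - cnj ?a * f w)) holomorphic_on ball 0 1"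
      using nz by (intro holomorphic_intros hol) auto
    show "cmod ((f w - ?a) / (1 - cnj ?a * f w)) < 1" if "cmod w < 1" for w
      using Moebius_function_norm_lt_1[of ?a "f w" 0] lt[OF that] lt[of 0]
      by (simp add: Moebius_function_simple)
  qed simp
  then have "cmod (?b - ?a) \<le> cmod z * cmod (1 - cnj ?a * ?b)"
    using nz[OF z] by (simp add: norm_divide divide_le_eq)
  then have 1: "(cmod (?b - ?a))\<^sup>2 \<le> (cmod z)\<^sup>2 * (cmod (1 - cnj ?a * ?b))\<^sup>2"
    by (metis norm_ge_zero power_mono power_mult_distrib)
  define u v r where "u = cmod ?b" and "v = cmod ?a" and "r = cmod z"
  \<comment> \<open>The defect from 1 of the squared pseudohyperbolic quotient has this numerator,
    which depends only on the moduli. The denominator shrinks when the values are replaced by their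
    moduli, so the quotient shrinks too.\<close>
  have id: "(cmod (1 - cnj ?a * ?b))\<^sup>2 - (cmod (?b - ?a))\<^sup>2 = (1 - u\<^sup>2) * (1 - v\<^sup>2)"
    unfolding u_def v_def cmod_power2 by (simp add: power2_eq_square algebra_simps)
  have "1 - u * v \<le> cmod (1 - cnj ?a * ?b)"
    using norm_triangle_ineq2[of 1 "cnj ?a * ?b"] by (simp add: norm_mult u_def v_def mult.commute)
  moreover have uv: "0 \<le> 1 - u * v"
    using lt[OF z] lt[of 0] mult_mono[of u 1 v 1] by (simp add: u_def v_def)
  ultimately have 2: "(1 - u * v)\<^sup>2 \<le> (cmod (1 - cnj ?a * ?b))\<^sup>2"
    by (intro power_mono) auto
  have r: "r\<^sup>2 \<le> 1" using z by (simp add: r_def power_le_one)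
  have "(1 - r\<^sup>2) * (1 - u * v)\<^sup>2 \<le> (1 - r\<^sup>2) * (cmod (1 - cnj ?a * ?b))\<^sup>2"
    using 2 r by (intro mult_left_mono) auto
  also have "\<dots> \<le> (1 - u\<^sup>2) * (1 - v\<^sup>2)"
    using 1 id by (simp add: r_def algebra_simps)
  also have "\<dots> = (1 - u * v)\<^sup>2 - (u - v)\<^sup>2"
    by (simp add: power2_eq_square algebra_simps)
  finally have "\<bar>u - v\<bar>\<^sup>2 \<le> (r * (1 - u * v))\<^sup>2"
    by (simp add: power_mult_distrib left_diff_distrib)
  moreover have "0 \<le> r * (1 - u * v)"
    by (rule mult_nonneg_nonneg[OF _ uv]) (simp add: r_def)
  ultimately have "\<bar>u - v\<bar> \<le> r * (1 - u * v)"
    by (rule power2_le_imp_le)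
  then show ?thesis by (simp add: u_def v_def r_def)
qed

text \<open>The condition on \<open>v\<close> holds for \<open>\<bar>Q\<bar>\<^sup>p + \<bar>X\<bar>\<^sup>2\<close> with any real \<open>p > 0\<close>: where \<open>Q\<close> does not vanish it
  has a holomorphic \<open>p\<close>-th power, and where it vanishes the other summand suffices.\<close>

lemma locally_modulus_max_principle:
  fixes v :: "complex \<Rightarrow> real"
  assumes r: "0 < r" and cont: "continuous_on (cball 0 r) v"
    and loc: "\<And>w. cmod w < r \<Longrightarrow> \<exists>G e. e > 0 \<and> ball w e \<subseteq> ball 0 r \<and> G holomorphic_on ball w e \<and>
        cmod (G w) = v w \<and> (\<forall>z\<in>ball w e. cmod (G z) \<le> v z)"
    and bd: "\<And>z. cmod z = r \<Longrightarrow> v z \<le> B"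
  shows "v 0 \<le> B"
proof -
  obtain m where m: "m \<in> cball 0 r" "\<And>z. z \<in> cball 0 r \<Longrightarrow> v z \<le> v m"
    using continuous_attains_sup[OF compact_cball _ cont] r by force
  \<comment> \<open>If the maximum is attained in the open disc, \<open>A\<close> is nonempty,
    closed by continuity, and open because the local \<open>G\<close> has maximal modulus at its
    centre and is constant. So \<open>v\<close> is constant up to the circle, where the bound
    holds.\<close>
  define A where "A = {z \<in> ball 0 r. v z = v m}"
  have "v m \<le> B"
  proof (cases "cmod m = r")
    case False
    have contb: "continuous_on (ball 0 r) v" using cont by (rule continuous_on_subset) auto
    have "closedin (top_of_set (ball 0 r)) A"
      unfolding A_def by (rule continuous_closedin_preimage_constant[OF contb])
    moreover have "openin (top_of_set (ball 0 r)) A"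
    proof (subst openin_open_eq)
      show "open A \<and> A \<subseteq> ball 0 r"
      proof
        show "open A" unfolding open_contains_ball
        proof
          fix w assume w: "w \<in> A"
          then have "cmod w < r" by (simp add: A_def)
          from loc[OF this] obtain G e where G: "e > 0" "ball w e \<subseteq> ball 0 r" "G holomorphic_on ball w e"
            "cmod (G w) = v w" "\<forall>z\<in>ball w e. cmod (G z) \<le> v z" by blast
          have vw: "v w = v m" using w by (simp add: A_def)
          have "G constant_on ball w e"
          proof (rule maximum_modulus_principle[OF G(3) _ _ _ _ centre_in_ball[THEN iffD2, OF G(1)]])
            fix z assume "z \<in> ball w e"
            then show "cmod (G z) \<le> cmod (G w)" using G m(2)[of z] vw by force
          qed auto
          then have c: "G z = G w" if "z \<in> ball w e" for z
            using that G(1) unfolding constant_on_def by (metis centre_in_ball)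
          have "z \<in> A" if "z \<in> ball w e" for z
            using that c[OF that] G m(2)[of z] vw by (force simp: A_def)
          then show "\<exists>e>0. ball w e \<subseteq> A" using G(1) by blast
        qed
      qed (auto simp: A_def)
    qed simp
    ultimately have "A = {} \<or> A = ball 0 r"
      using connected_clopen[THEN iffD1, OF connected_ball[of "0 :: complex" r]] by blast
    moreover have "m \<in> A" using False m by (auto simp: A_def)
    ultimately have AB: "A = ball 0 r" by blast
    have *: "v z = v m" if "z \<in> ball 0 r" for z
    proof -
      have "z \<in> A" unfolding AB by (rule that)
      then show ?thesis unfolding A_def by simp
    qed
    have "v z = v m" if "z \<in> closure (ball 0 r)" for z
      by (rule continuous_constant_on_closure[OF _ * that]) (use cont r in auto)
    from this[of "of_real r"] have "v (of_real r) = v m" using r by simp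
    then show ?thesis using bd[of "of_real r"] r by simp
  qed (use bd in auto)
  with m(2)[of 0] r show ?thesis by simp
qed

lemma modulus_power_sum_max_principle:
  assumes Q: "Q holomorphic_on ball 0 R" and X: "X holomorphic_on ball 0 R"
    and r: "0 < r" "r < R" and p: "p > 0"
    and bd: "\<And>z. cmod z = r \<Longrightarrow> cmod (Q z) powr p + (cmod (X z))\<^sup>2 \<le> B"
  shows "cmod (Q 0) powr p + (cmod (X 0))\<^sup>2 \<le> B"
proof (rule locally_modulus_max_principle[where v = "\<lambda>z. cmod (Q z) powr p + (cmod (X z))\<^sup>2", OF r(1) _ _ bd])
  have "continuous_on (cball 0 r) Q" "continuous_on (cball 0 r) X"
    using Q X r by (auto intro!: holomorphic_on_imp_continuous_on elim: holomorphic_on_subset)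
  then show "continuous_on (cball 0 r) (\<lambda>z. cmod (Q z) powr p + (cmod (X z))\<^sup>2)"
    using p by (intro continuous_intros continuous_on_powr') auto
next
  fix w :: complex assume w: "cmod w < r"
  \<comment> \<open>The unimodular \<open>c\<close> turns the square of \<open>X w\<close> into its
    squared modulus, so that at \<open>w\<close> the two summands of \<open>?G\<close> below add
    without loss.\<close>
  define c where "c = (if X w = 0 then 1 else cnj (X w) / X w)"
  have c: "cmod c = 1" "c * (X w)\<^sup>2 = of_real ((cmod (X w))\<^sup>2)"
  proof -
    show "cmod c = 1" by (simp add: c_def norm_divide)
    show "c * (X w)\<^sup>2 = of_real ((cmod (X w))\<^sup>2)"
      unfolding complex_norm_square by (simp add: c_def power2_eq_square)
  qed
  show "\<exists>G e. e > 0 \<and> ball w e \<subseteq> ball 0 r \<and> G holomorphic_on ball w e \<and>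
        cmod (G w) = cmod (Q w) powr p + (cmod (X w))\<^sup>2 \<and>
        (\<forall>z\<in>ball w e. cmod (G z) \<le> cmod (Q z) powr p + (cmod (X z))\<^sup>2)"
  proof (cases "Q w = 0")
    case True
    have sub: "ball w (r - cmod w) \<subseteq> ball 0 r"
    proof
      fix z assume "z \<in> ball w (r - cmod w)"
      then show "z \<in> ball 0 r"
        using norm_triangle_sub[of z w] by (simp add: dist_norm norm_minus_commute)
    qed
    then have "X holomorphic_on ball w (r - cmod w)"
      using X r by (elim holomorphic_on_subset) auto
    then show ?thesis
      using True w sub by (intro exI[of _ "\<lambda>z. (X z)\<^sup>2"] exI[of _ "r - cmod w"])
        (auto intro!: holomorphic_intros simp: norm_power)
  next
    case False
    have op: "open (ball 0 r)" "w \<in> ball 0 r" using w by auto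
    have contQ: "continuous_on (ball 0 r) (\<lambda>z. Q z / Q w)"
      using False r by (intro continuous_intros holomorphic_on_imp_continuous_on
          holomorphic_on_subset[OF Q]) auto
    have "open {z \<in> ball 0 r. Q z / Q w \<in> ball 1 1}"
      using continuous_open_preimage[OF contQ open_ball open_ball] by (simp add: vimage_def Int_def)
    moreover have "w \<in> {z \<in> ball 0 r. Q z / Q w \<in> ball 1 1}" using op False by simp
    ultimately obtain e where e: "e > 0" "ball w e \<subseteq> {z \<in> ball 0 r. Q z / Q w \<in> ball 1 1}"
      unfolding open_contains_ball by blast
    have np: "Q z / Q w \<notin> \<real>\<^sub>\<le>\<^sub>0" if "z \<in> ball w e" for z
    proof
      assume "Q z / Q w \<in> \<real>\<^sub>\<le>\<^sub>0"
      then have "Re (Q z / Q w) \<le> 0" by (simp add: complex_nonpos_Reals_iff)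
      moreover have "cmod (1 - Q z / Q w) < 1" using that e by (auto simp: dist_norm)
      ultimately show False using abs_Re_le_cmod[of "1 - Q z / Q w"] by simp
    qed
    \<comment> \<open>A branch of the power \<open>p\<close> of \<open>Q\<close>, up to a unimodular
      constant; the quotient avoids the cut of \<open>Ln\<close>, and the normalisation makes the
      value at \<open>w\<close> positive.\<close>
    let ?H = "\<lambda>z. of_real (cmod (Q w) powr p) * exp (of_real p * Ln (Q z / Q w))"
    have H: "cmod (?H z) = cmod (Q z) powr p" if "z \<in> ball w e" for z
    proof -
      have nz: "Q z \<noteq> 0" using np[OF that] by auto
      have "cmod (exp (of_real p * Ln (Q z / Q w))) = (cmod (Q z / Q w)) powr p"
        using nz False by (simp add: powr_def Ln_Reals_eq)
      also have "\<dots> = cmod (Q z) powr p / cmod (Q w) powr p" by (simp add: norm_divide powr_divide)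
      finally show ?thesis using False by (simp add: norm_mult)
    qed
    let ?G = "\<lambda>z. ?H z + c * (X z)\<^sup>2"
    have holQ: "Q holomorphic_on ball w e" "X holomorphic_on ball w e"
      using Q X e r by (auto elim!: holomorphic_on_subset)
    have "?G holomorphic_on ball w e"
      using np False by (intro holomorphic_intros holQ) auto
    moreover have "cmod (?G w) = cmod (Q w) powr p + (cmod (X w))\<^sup>2"
    proof -
      have "?G w = of_real (cmod (Q w) powr p + (cmod (X w))\<^sup>2)" using c False by simp
      then show ?thesis by (simp only: norm_of_real) simp
    qed
    moreover have "cmod (?G z) \<le> cmod (Q z) powr p + (cmod (X z))\<^sup>2" if "z \<in> ball w e" for z
      using norm_triangle_ineq[of "?H z" "c * (X z)\<^sup>2"] H[OF that] c by (simp add: norm_mult norm_power)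
    ultimately show ?thesis using e by (intro exI[of _ ?G] exI[of _ e]) blast
  qed
qed

section \<open>Multivalued holomorphic functions\<close>

lemma holo_disc_has_derivative:
  fixes f :: "complex \<Rightarrow> complex ^ 'n"
  assumes f: "holo_disc f U" and U: "open U" "z \<in> U"
  shows "(f has_derivative (\<lambda>h. h *s (\<chi> i. deriv (\<lambda>\<zeta>. f \<zeta> $ i) z))) (at z)"
proof -
  let ?c = "\<lambda>i. deriv (\<lambda>\<zeta>. f \<zeta> $ i) z"
  have bl: "bounded_linear (\<lambda>h. h *s (\<chi> i. ?c i))"
    by (auto intro!: linearI simp: linear_conv_bounded_linear[symmetric] vec_eq_iff algebra_simps)
  have "((\<lambda>y. (1 / norm (y - z)) *\<^sub>R (f y - (f z + (y - z) *s (\<chi> i. ?c i)))) \<longlongrightarrow> 0) (at z)"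
  proof (rule vec_tendstoI)
    fix i
    have "((\<lambda>\<zeta>. f \<zeta> $ i) has_field_derivative ?c i) (at z)"
      using f U unfolding holo_disc_def by (blast intro: holomorphic_derivI)
    then have "((\<lambda>y. (1 / norm (y - z)) *\<^sub>R (f y $ i - (f z $ i + ?c i * (y - z)))) \<longlongrightarrow> 0) (at z)"
      by (simp add: has_field_derivative_def has_derivative_within)
    then show "((\<lambda>y. ((1 / norm (y - z)) *\<^sub>R (f y - (f z + (y - z) *s (\<chi> i. ?c i)))) $ i) \<longlongrightarrow> 0 $ i) (at z)"
      by (simp add: algebra_simps)
  qed
  with bl show ?thesis by (simp add: has_derivative_within)
qed

text \<open>The chain rule; complex linearity of \<open>F'\<close> makes the composite derivative
  multiplication by the number \<open>F' ?v\<close>.\<close>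

lemma holo_scalar_compose_holo_disc:
  assumes F: "holo_scalar F \<Omega>" and f: "holo_disc f U" and U: "open U" and fU: "f ` U \<subseteq> \<Omega>"
  shows "(\<lambda>\<zeta>. F (f \<zeta>)) holomorphic_on U"
  unfolding holomorphic_on_def
proof
  fix z assume z: "z \<in> U"
  let ?v = "\<chi> i. deriv (\<lambda>\<zeta>. f \<zeta> $ i) z"
  from F fU z obtain F' where F': "(F has_derivative F') (at (f z) within \<Omega>)"
    "Vector_Spaces.linear (*s) (*) F'"
    unfolding holo_scalar_def by blast
  have "((\<lambda>\<zeta>. F (f \<zeta>)) has_derivative (\<lambda>h. F' (h *s ?v))) (at z within U)"
  proof (rule has_derivative_in_compose[of f "\<lambda>h. h *s ?v" z U F F'])
    show "(f has_derivative (\<lambda>h. h *s ?v)) (at z within U)"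
      using holo_disc_has_derivative[OF f U z] by (rule has_derivative_at_withinI)
    show "(F has_derivative F') (at (f z) within f ` U)"
      using F'(1) fU by (rule has_derivative_subset)
  qed
  moreover have "F' (h *s ?v) = F' ?v * h" for h
    using module_hom.scale[OF Vector_Spaces.linear.axioms(3)[OF F'(2)], of h ?v]
    by (simp add: mult.commute)
  ultimately have "((\<lambda>\<zeta>. F (f \<zeta>)) has_field_derivative F' ?v) (at z within U)"
    by (simp add: has_field_derivative_def fun_eq_iff)
  then show "(\<lambda>\<zeta>. F (f \<zeta>)) field_differentiable at z within U"
    by (auto simp: field_differentiable_def)
qed

text \<open>Continuity of roots. The polynomial with roots \<open>l \<zeta>\<close> vanishes at
  \<open>l \<zeta> $ i\<close>, so the product of the distances from there to the values at
  \<open>z0\<close> is the modulus of a difference of two polynomials, at most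
  \<open>d \<zeta>\<close>. The numbering of the branches is arbitrary, hence only some
  \<open>j\<close> is claimed.\<close>

lemma roots_near:
  fixes l :: "complex \<Rightarrow> complex ^ 'n"
  assumes U: "open U" "z0 \<in> U" and hol: "\<And>k. (\<lambda>\<zeta>. elem_sym k (l \<zeta>)) holomorphic_on U"
    and bd: "\<And>\<zeta> i. \<zeta> \<in> U \<Longrightarrow> cmod (l \<zeta> $ i) \<le> M" and r: "r > 0"
  shows "\<exists>e>0. ball z0 e \<subseteq> U \<and> (\<forall>\<zeta>\<in>ball z0 e. \<forall>i. \<exists>j. dist (l \<zeta> $ i) (l z0 $ j) < r)"
proof -
  let ?n = "CARD('n)"
  let ?B = "max 1 M"
  define d where "d \<zeta> = (\<Sum>k\<le>?n. cmod (elem_sym k (l \<zeta>) - elem_sym k (l z0)) * ?B ^ ?n)" for \<zeta>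
  have "continuous_on U d"
    unfolding d_def by (intro continuous_intros holomorphic_on_imp_continuous_on hol)
  then have "open {\<zeta> \<in> U. d \<zeta> \<in> {..<r ^ ?n}}"
    using continuous_open_preimage[OF _ U(1) open_lessThan, of d] by (simp add: vimage_def Int_def)
  moreover have "z0 \<in> {\<zeta> \<in> U. d \<zeta> \<in> {..<r ^ ?n}}"
    using U r by (simp add: d_def)
  ultimately obtain e where e: "e > 0" "ball z0 e \<subseteq> {\<zeta> \<in> U. d \<zeta> \<in> {..<r ^ ?n}}"
    unfolding open_contains_ball by blast
  have "\<exists>j. dist (l \<zeta> $ i) (l z0 $ j) < r" if \<zeta>: "\<zeta> \<in> ball z0 e" for \<zeta> i
  proof (rule ccontr)
    assume "\<not> ?thesis"
    then have ge: "r \<le> cmod (l \<zeta> $ i - l z0 $ j)" for j by (auto simp: dist_norm not_less)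
    let ?t = "l \<zeta> $ i"
    have \<zeta>U: "\<zeta> \<in> U" "d \<zeta> < r ^ ?n" using e \<zeta> by auto
    have "(\<Prod>j\<in>UNIV. ?t - l \<zeta> $ j) = 0" by (auto intro: prod_zero)
    then have "(\<Prod>j\<in>UNIV. ?t - l z0 $ j) = (\<Prod>j\<in>UNIV. ?t - l z0 $ j) - (\<Prod>j\<in>UNIV. ?t - l \<zeta> $ j)"
      by simp
    also have "\<dots> = (\<Sum>k\<le>?n. (-1) ^ k * (elem_sym k (l z0) - elem_sym k (l \<zeta>)) * ?t ^ (?n - k))"
      unfolding vieta by (simp add: sum_subtractf[symmetric] algebra_simps)
    finally have "cmod (\<Prod>j\<in>UNIV. ?t - l z0 $ j) \<le> d \<zeta>"
      unfolding d_def
    proof (elim ssubst, intro order_trans[OF norm_sum] sum_mono)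
      fix k
      have "cmod ?t ^ (?n - k) \<le> ?B ^ (?n - k)" using bd[OF \<zeta>U(1), of i] by (intro power_mono) auto
      also have "\<dots> \<le> ?B ^ ?n" by (intro power_increasing) auto
      finally show "cmod ((-1) ^ k * (elem_sym k (l z0) - elem_sym k (l \<zeta>)) * ?t ^ (?n - k))
          \<le> cmod (elem_sym k (l \<zeta>) - elem_sym k (l z0)) * ?B ^ ?n"
        by (simp add: norm_mult norm_power mult_left_mono norm_minus_commute)
    qed
    moreover have "r ^ ?n \<le> cmod (\<Prod>j\<in>UNIV. ?t - l z0 $ j)"
      using prod_mono[of "UNIV :: 'n set" "\<lambda>_. r" "\<lambda>j. cmod (?t - l z0 $ j)"] ge r
      by (simp add: prod_norm)
    ultimately show False using \<zeta>U by simp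
  qed
  then show ?thesis using e by blast
qed

text \<open>Near a point the sum is the sum, over small circles around the distinct branch values, of the
  Cauchy integrals of \<open>G\<close> against the logarithmic derivative of \<open>t \<mapsto> \<Prod>\<^sub>i (t - l\<^sub>i(\<zeta>))\<close>.\<close>

lemma sum_compose_holomorphic:
  fixes l :: "complex \<Rightarrow> complex ^ 'n"
  assumes U: "open U" and hol: "\<And>k. (\<lambda>\<zeta>. elem_sym k (l \<zeta>)) holomorphic_on U"
    and lD: "\<And>\<zeta> i. \<zeta> \<in> U \<Longrightarrow> l \<zeta> $ i \<in> D" and D: "bounded D" "open D"
    and G: "G holomorphic_on D"
  shows "(\<lambda>\<zeta>. \<Sum>i\<in>UNIV. G (l \<zeta> $ i)) holomorphic_on U"
  unfolding holomorphic_on_def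
proof
  fix z0 assume z0: "z0 \<in> U"
  let ?n = "CARD('n)"
  obtain M where M: "\<And>t. t \<in> D \<Longrightarrow> cmod t \<le> M"
    using D(1) unfolding bounded_iff by blast
  define Y where "Y = range (($) (l z0))"
  have YD: "Y \<subseteq> D" and finY: "finite Y" using lD[OF z0] by (auto simp: Y_def)
  have "\<forall>y\<in>Y. \<forall>\<^sub>F r in at_right 0. cball y r \<subseteq> D \<and> (\<forall>y'\<in>Y. y' \<noteq> y \<longrightarrow> 2 * r < dist y y')"
  proof
    fix y assume y: "y \<in> Y"
    obtain e where e: "e > 0" "cball y e \<subseteq> D"
      using D(2) YD y open_contains_cball by blast
    have "\<forall>\<^sub>F r in at_right 0. cball y r \<subseteq> D"
      by (rule eventually_at_rightI[of 0 e]) (use e in \<open>auto simp: subset_iff\<close>)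
    moreover have "\<forall>\<^sub>F r in at_right 0. 2 * r < dist y y'" if "y' \<noteq> y" for y'
      by (rule eventually_at_rightI[of 0 "dist y y' / 2"]) (use that in auto)
    then have "\<forall>\<^sub>F r in at_right 0. \<forall>y'\<in>Y. y' \<noteq> y \<longrightarrow> 2 * r < dist y y'"
      by (subst eventually_ball_finite_distrib[OF finY]) auto
    ultimately show "\<forall>\<^sub>F r in at_right 0. cball y r \<subseteq> D \<and> (\<forall>y'\<in>Y. y' \<noteq> y \<longrightarrow> 2 * r < dist y y')"
      by (rule eventually_conj)
  qed
  then have "\<forall>\<^sub>F r in at_right (0::real). \<forall>y\<in>Y. cball y r \<subseteq> D \<and> (\<forall>y'\<in>Y. y' \<noteq> y \<longrightarrow> 2 * r < dist y y')"
    by (rule eventually_ball_finite[OF finY])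
  then have "\<forall>\<^sub>F r in at_right (0::real). 0 < r \<and> (\<forall>y\<in>Y. cball y r \<subseteq> D \<and> (\<forall>y'\<in>Y. y' \<noteq> y \<longrightarrow> 2 * r < dist y y'))"
    by (rule eventually_conj[OF eventually_at_right_less])
  then obtain r where r: "r > 0" "\<And>y. y \<in> Y \<Longrightarrow> cball y r \<subseteq> D"
    "\<And>y y'. y \<in> Y \<Longrightarrow> y' \<in> Y \<Longrightarrow> y' \<noteq> y \<Longrightarrow> 2 * r < dist y y'"
    using eventually_happens'[OF trivial_limit_at_right_real] by blast
  obtain e where e: "e > 0" "ball z0 e \<subseteq> U"
    and near: "\<And>\<zeta> i. \<zeta> \<in> ball z0 e \<Longrightarrow> \<exists>y\<in>Y. dist (l \<zeta> $ i) y < r"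
    using roots_near[OF U z0 hol M[OF lD] r(1)] unfolding Y_def by blast
  define V where "V = ball z0 e"
  \<comment> \<open>Such a branch value lies in the disc about another point of \<open>Y\<close>,
    and the centres are more than \<open>2 * r\<close> apart; so no branch value lies on any of the
    circles.\<close>
  have off: "r < dist (l \<zeta> $ i) y" if \<zeta>: "\<zeta> \<in> V" "y \<in> Y" "\<not> dist (l \<zeta> $ i) y < r" for \<zeta> i y
  proof -
    obtain y' where y': "y' \<in> Y" "dist (l \<zeta> $ i) y' < r" using near \<zeta>(1) V_def by blast
    then have "2 * r < dist y y'" using r(3)[OF \<zeta>(2), of y'] \<zeta>(3) by auto
    then show ?thesis using y'(2) dist_triangle3[of y y' "l \<zeta> $ i"] by simp
  qed
  \<comment> \<open>\<open>P1\<close> is the derivative of \<open>P\<close> in \<open>t\<close>,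
    while \<open>Q\<close> and \<open>Q1\<close> are the derivatives of \<open>P\<close> and
    \<open>P1\<close> in \<open>\<zeta>\<close>.\<close>
  define P where "P \<zeta> t = (\<Sum>k\<le>?n. (-1) ^ k * elem_sym k (l \<zeta>) * t ^ (?n - k))" for \<zeta> t
  define P1 where "P1 \<zeta> t = (\<Sum>k\<le>?n. (-1) ^ k * elem_sym k (l \<zeta>) * (of_nat (?n - k) * t ^ (?n - k - 1)))" for \<zeta> t
  define E where "E k \<zeta> = deriv (\<lambda>\<zeta>. elem_sym k (l \<zeta>)) \<zeta>" for k \<zeta>
  define Q where "Q \<zeta> t = (\<Sum>k\<le>?n. (-1) ^ k * E k \<zeta> * t ^ (?n - k))" for \<zeta> t
  define Q1 where "Q1 \<zeta> t = (\<Sum>k\<le>?n. (-1) ^ k * E k \<zeta> * (of_nat (?n - k) * t ^ (?n - k - 1)))" for \<zeta> t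
  have Pprod: "P \<zeta> t = (\<Prod>i\<in>UNIV. t - l \<zeta> $ i)" for \<zeta> t
    unfolding P_def vieta ..
  have ne: "t \<noteq> l \<zeta> $ i" if "\<zeta> \<in> V" "y \<in> Y" "t \<in> sphere y r" for t \<zeta> y i
    using off[OF that(1,2), of i] that(3) by (auto simp: dist_commute)
  have Pnz: "P \<zeta> t \<noteq> 0" if "\<zeta> \<in> V" "y \<in> Y" "t \<in> sphere y r" for t \<zeta> y
    using ne[OF that] by (auto simp: Pprod)
  have logderiv: "(\<Sum>i\<in>UNIV. 1 / (t - l \<zeta> $ i)) = P1 \<zeta> t / P \<zeta> t"
    if "\<zeta> \<in> V" "y \<in> Y" "t \<in> sphere y r" for t \<zeta> y
  proof -
    have "(P \<zeta> has_field_derivative P1 \<zeta> t) (at t)"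
      unfolding P_def P1_def
      by (rule DERIV_sum) (auto intro!: derivative_eq_intros simp: algebra_simps)
    moreover have "(P \<zeta> has_field_derivative P \<zeta> t * (\<Sum>i\<in>UNIV. 1 / (t - l \<zeta> $ i))) (at t)"
      unfolding Pprod using ne[OF that] by (auto intro!: derivative_eq_intros has_field_derivative_prod' simp: field_simps)
    ultimately show ?thesis using DERIV_unique Pnz[OF that] by (metis nonzero_mult_div_cancel_left)
  qed
  have G': "G holomorphic_on cball y r" if "y \<in> Y" for y
    using G r(2)[OF that] by (rule holomorphic_on_subset)
  have cauchy: "contour_integral (circlepath y r) (\<lambda>t. G t * (P1 \<zeta> t / P \<zeta> t))
      = (\<Sum>i\<in>UNIV. if dist (l \<zeta> $ i) y < r then 2 * of_real pi * \<i> * G (l \<zeta> $ i) else 0)"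
    if \<zeta>: "\<zeta> \<in> V" and y: "y \<in> Y" for \<zeta> y
  proof -
    have "((\<lambda>t. \<Sum>i\<in>UNIV. G t / (t - l \<zeta> $ i)) has_contour_integral
       (\<Sum>i\<in>UNIV. if dist (l \<zeta> $ i) y < r then 2 * of_real pi * \<i> * G (l \<zeta> $ i) else 0)) (circlepath y r)"
    proof (rule has_contour_integral_sum)
      fix i
      show "((\<lambda>t. G t / (t - l \<zeta> $ i)) has_contour_integral
         (if dist (l \<zeta> $ i) y < r then 2 * of_real pi * \<i> * G (l \<zeta> $ i) else 0)) (circlepath y r)"
      proof (cases "dist (l \<zeta> $ i) y < r")
        case True
        then show ?thesis using Cauchy_integral_circlepath_simple[OF G'[OF y]] by (simp add: dist_norm)
      next
        case False
        have "((\<lambda>t. G t / (t - l \<zeta> $ i)) has_contour_integral 0) (circlepath y r)"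
        proof (rule Cauchy_theorem_convex_simple[where S = "cball y r"])
          show "(\<lambda>t. G t / (t - l \<zeta> $ i)) holomorphic_on cball y r"
            using off[OF \<zeta> y False] by (intro holomorphic_intros G'[OF y]) (auto simp: dist_commute)
        qed (use r(1) in auto)
        then show ?thesis using False by simp
      qed
    qed simp
    then have "((\<lambda>t. G t * (P1 \<zeta> t / P \<zeta> t)) has_contour_integral
       (\<Sum>i\<in>UNIV. if dist (l \<zeta> $ i) y < r then 2 * of_real pi * \<i> * G (l \<zeta> $ i) else 0)) (circlepath y r)"
    proof (rule has_contour_integral_eq)
      fix t assume "t \<in> path_image (circlepath y r)"
      then have t: "t \<in> sphere y r" using r(1) by simp
      show "(\<Sum>i\<in>UNIV. G t / (t - l \<zeta> $ i)) = G t * (P1 \<zeta> t / P \<zeta> t)"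
        unfolding logderiv[OF \<zeta> y t, symmetric] by (simp add: sum_distrib_left)
    qed
    then show ?thesis by (rule contour_integral_unique)
  qed
  have total: "(\<Sum>i\<in>UNIV. G (l \<zeta> $ i))
      = (\<Sum>y\<in>Y. contour_integral (circlepath y r) (\<lambda>t. G t * (P1 \<zeta> t / P \<zeta> t))) / (2 * of_real pi * \<i>)"
    if \<zeta>: "\<zeta> \<in> V" for \<zeta>
  proof -
    have "(\<Sum>y\<in>Y. contour_integral (circlepath y r) (\<lambda>t. G t * (P1 \<zeta> t / P \<zeta> t)))
       = (\<Sum>i\<in>UNIV. \<Sum>y\<in>Y. if dist (l \<zeta> $ i) y < r then 2 * of_real pi * \<i> * G (l \<zeta> $ i) else 0)"
      using cauchy[OF \<zeta>] by (simp add: sum.swap[of _ Y])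
    also have "\<dots> = (\<Sum>i\<in>UNIV. 2 * of_real pi * \<i> * G (l \<zeta> $ i))"
    proof (rule sum.cong)
      fix i
      obtain y' where y': "y' \<in> Y" "dist (l \<zeta> $ i) y' < r" using near \<zeta> V_def by blast
      have "dist (l \<zeta> $ i) y < r \<longleftrightarrow> y = y'" if "y \<in> Y" for y
        using y' r(3)[OF that y'(1)] dist_triangle3[of y y' "l \<zeta> $ i"] by force
      then have "(\<Sum>y\<in>Y. if dist (l \<zeta> $ i) y < r then 2 * of_real pi * \<i> * G (l \<zeta> $ i) else 0)
          = (\<Sum>y\<in>Y. if y = y' then 2 * of_real pi * \<i> * G (l \<zeta> $ i) else 0)"
        by (intro sum.cong) auto
      then show "(\<Sum>y\<in>Y. if dist (l \<zeta> $ i) y < r then 2 * of_real pi * \<i> * G (l \<zeta> $ i) else 0)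
          = 2 * of_real pi * \<i> * G (l \<zeta> $ i)"
        using y'(1) finY by simp
    qed simp
    finally show ?thesis by (simp add: sum_distrib_left[symmetric])
  qed
  have hol_int: "(\<lambda>\<zeta>. contour_integral (circlepath y r) (\<lambda>t. G t * (P1 \<zeta> t / P \<zeta> t))) holomorphic_on V"
    if y: "y \<in> Y" for y
  proof -
    define g where "g x = circlepath y r x" for x
    \<comment> \<open>The velocity of the circle \<open>g\<close>: the contour integral becomes an
      integral over the unit interval, to be differentiated in \<open>\<zeta>\<close> under the
      integral sign.\<close>
    define w where "w x = 2 * of_real pi * \<i> * of_real r * exp (2 * of_real pi * \<i> * of_real x)" for x :: real
    have gs: "g x \<in> sphere y r" if "x \<in> {0..1}" for x
      using that r(1) path_image_circlepath_nonneg[of r y] unfolding g_def path_image_def by auto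
    have contg: "continuous_on A g" for A
      unfolding g_def circlepath by (intro continuous_intros)
    have contw: "continuous_on A w" for A
      unfolding w_def by (intro continuous_intros)
    have Gg: "continuous_on {0..1} (\<lambda>x. G (g x))"
      using holomorphic_on_imp_continuous_on[OF G'[OF y]]
      by (rule continuous_on_compose2[OF _ contg]) (use gs in force)
    have VU: "V \<subseteq> U" using e by (simp add: V_def)
    have ce: "continuous_on V (\<lambda>\<zeta>. elem_sym k (l \<zeta>))" for k
      by (rule holomorphic_on_imp_continuous_on[OF holomorphic_on_subset[OF hol VU]])
    have "E k holomorphic_on V" for k
      unfolding E_def by (rule holomorphic_on_subset[OF holomorphic_deriv[OF hol U] VU])
    then have cE: "continuous_on V (E k)" for k
      by (rule holomorphic_on_imp_continuous_on)
    have dE: "((\<lambda>\<zeta>. elem_sym k (l \<zeta>)) has_field_derivative E k \<zeta>) (at \<zeta> within V)" if "\<zeta> \<in> V" for k \<zeta>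
      unfolding E_def
      by (rule has_field_derivative_at_within[OF holomorphic_derivI[OF hol U]]) (use that VU in auto)
    let ?fx = "\<lambda>\<zeta> x. G (g x) * ((Q1 \<zeta> (g x) * P \<zeta> (g x) - P1 \<zeta> (g x) * Q \<zeta> (g x)) / (P \<zeta> (g x) * P \<zeta> (g x))) * w x"
    have "(\<lambda>\<zeta>. integral (cbox 0 1) (\<lambda>x. G (g x) * (P1 \<zeta> (g x) / P \<zeta> (g x)) * w x)) holomorphic_on V"
    proof (rule leibniz_rule_holomorphic[where fx = ?fx])
      fix \<zeta> x assume \<zeta>: "\<zeta> \<in> V" and x: "x \<in> cbox 0 (1::real)"
      have "P \<zeta> (g x) \<noteq> 0" using Pnz[OF \<zeta> y gs] x by simp
      moreover have "((\<lambda>\<zeta>. P \<zeta> (g x)) has_field_derivative Q \<zeta> (g x)) (at \<zeta> within V)"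
        unfolding P_def Q_def
        by (rule DERIV_sum) (auto intro!: derivative_eq_intros dE[OF \<zeta>])
      moreover have "((\<lambda>\<zeta>. P1 \<zeta> (g x)) has_field_derivative Q1 \<zeta> (g x)) (at \<zeta> within V)"
        unfolding P1_def Q1_def
        by (rule DERIV_sum) (auto intro!: derivative_eq_intros dE[OF \<zeta>])
      ultimately show "((\<lambda>\<zeta>. G (g x) * (P1 \<zeta> (g x) / P \<zeta> (g x)) * w x) has_field_derivative ?fx \<zeta> x) (at \<zeta> within V)"
        by (intro DERIV_cmult DERIV_cmult_right DERIV_divide)
    next
      fix \<zeta> assume \<zeta>: "\<zeta> \<in> V"
      have "continuous_on (cbox 0 1) (\<lambda>x. G (g x) * (P1 \<zeta> (g x) / P \<zeta> (g x)) * w x)"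
        unfolding P_def P1_def using Gg Pnz[OF \<zeta> y gs, unfolded P_def]
        by (intro continuous_intros contg contw) auto
      then show "(\<lambda>x. G (g x) * (P1 \<zeta> (g x) / P \<zeta> (g x)) * w x) integrable_on cbox 0 1"
        by (rule integrable_continuous)
    next
      have c1: "continuous_on (V \<times> {0..1}) (\<lambda>p. h (fst p))" if "continuous_on V h" for h :: "complex \<Rightarrow> complex"
        by (rule continuous_on_compose2[OF that]) (auto intro: continuous_intros)
      have c2: "continuous_on (V \<times> {0..1}) (\<lambda>p. h (snd p))" if "continuous_on {0..1} h" for h :: "real \<Rightarrow> complex"
        by (rule continuous_on_compose2[OF that]) (auto intro: continuous_intros)
      have "continuous_on (V \<times> {0..1}) (\<lambda>p. ?fx (fst p) (snd p))"
        unfolding P_def P1_def Q_def Q1_def using Pnz[OF _ y gs, unfolded P_def]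
        by (intro continuous_intros c1[OF ce] c1[OF cE] c2[OF contg] c2[OF contw] c2[OF Gg]) auto
      then show "continuous_on (V \<times> cbox 0 1) (\<lambda>(\<zeta>, x). ?fx \<zeta> x)"
        by (simp add: case_prod_beta')
    qed (simp add: V_def)
    then show ?thesis
      by (simp add: contour_integral_integral vector_derivative_circlepath g_def w_def)
  qed
  have "(\<lambda>\<zeta>. (\<Sum>y\<in>Y. contour_integral (circlepath y r) (\<lambda>t. G t * (P1 \<zeta> t / P \<zeta> t))) / (2 * of_real pi * \<i>))
     holomorphic_on V"
    by (intro holomorphic_intros hol_int) auto
  then have "(\<lambda>\<zeta>. \<Sum>i\<in>UNIV. G (l \<zeta> $ i)) holomorphic_on V"
    by (rule holomorphic_transform) (rule total[symmetric])
  then have "(\<lambda>\<zeta>. \<Sum>i\<in>UNIV. G (l \<zeta> $ i)) field_differentiable at z0"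
    using e(1) by (intro holomorphic_on_imp_differentiable_at[of _ V]) (auto simp: V_def)
  then show "(\<lambda>\<zeta>. \<Sum>i\<in>UNIV. G (l \<zeta> $ i)) field_differentiable at z0 within U"
    by (rule field_differentiable_at_within)
qed

text \<open>Power sums suffice by Newton's identities, and the binomial theorem splits them into
  sums of powers of \<open>G\<close> over the branches. The shift \<open>c\<close> serves for
  deviations from the mean and from fixed points.\<close>

lemma elem_sym_compose_holomorphic:
  fixes l :: "complex \<Rightarrow> complex ^ 'n"
  assumes U: "open U" and hol: "\<And>k. (\<lambda>\<zeta>. elem_sym k (l \<zeta>)) holomorphic_on U"
    and lD: "\<And>\<zeta> i. \<zeta> \<in> U \<Longrightarrow> l \<zeta> $ i \<in> D" and D: "bounded D" "open D"
    and G: "G holomorphic_on D" and c: "c holomorphic_on U"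
  shows "(\<lambda>\<zeta>. elem_sym k (\<chi> j. G (l \<zeta> $ j) - c \<zeta>)) holomorphic_on U"
proof (rule elem_sym_holomorphic_of_power_sums)
  fix i :: nat
  have e: "(\<Sum>j\<in>UNIV. (\<chi> j. G (l \<zeta> $ j) - c \<zeta>) $ j ^ i)
      = (\<Sum>m\<le>i. of_nat (i choose m) * (\<Sum>j\<in>UNIV. (\<lambda>t. G t ^ m) (l \<zeta> $ j)) * (- c \<zeta>) ^ (i - m))" for \<zeta>
  proof -
    have "(\<Sum>j\<in>UNIV. (\<chi> j. G (l \<zeta> $ j) - c \<zeta>) $ j ^ i) = (\<Sum>j\<in>UNIV. (G (l \<zeta> $ j) + (- c \<zeta>)) ^ i)"
      by simp
    also have "\<dots> = (\<Sum>m\<le>i. \<Sum>j\<in>UNIV. of_nat (i choose m) * G (l \<zeta> $ j) ^ m * (- c \<zeta>) ^ (i - m))"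
      unfolding binomial_ring by (rule sum.swap)
    finally show ?thesis by (simp add: sum_distrib_left sum_distrib_right)
  qed
  show "(\<lambda>\<zeta>. \<Sum>j\<in>UNIV. (\<chi> j. G (l \<zeta> $ j) - c \<zeta>) $ j ^ i) holomorphic_on U"
    unfolding e by (intro holomorphic_intros c sum_compose_holomorphic[OF U hol lD D] G)
qed

section \<open>Almost extremal discs and Schwarz estimates\<close>

lemma artanh_real_strict_mono:
  fixes x y :: real
  assumes "0 \<le> x" "x < y" "y < 1"
  shows "artanh x < artanh y"
proof -
  have "(1 + x) / (1 - x) < (1 + y) / (1 - y)" using assms by (simp add: field_simps)
  moreover have "0 < (1 + x) / (1 - x)" using assms by simp
  ultimately show ?thesis unfolding artanh_def by simp
qed

lemma artanh_real_mono:
  fixes x y :: real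
  shows "0 \<le> x \<Longrightarrow> x \<le> y \<Longrightarrow> y < 1 \<Longrightarrow> artanh x \<le> artanh y"
  using artanh_real_strict_mono[of x y] by (cases "x = y") auto

text \<open>A bound on all competitors \<open>F\<close> bounds the Caratheodory distance, hence the
  infimum in \<open>lempert\<close>, so some disc has its parameter below \<open>s'\<close>. The
  room between \<open>s\<close> and \<open>s'\<close> is there because the infimum may not be
  attained. A rotation makes the parameter real and nonnegative.\<close>

lemma lempert_disc_exists:
  fixes \<Omega> :: "(complex ^ 'n) set"
  assumes eq: "caratheodory \<Omega> w z = lempert \<Omega> w z"
    and bd: "\<And>F. holo_scalar F \<Omega> \<Longrightarrow> F ` \<Omega> \<subseteq> ball 0 1 \<Longrightarrow> F w = 0 \<Longrightarrow> cmod (F z) \<le> s"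
    and s: "0 \<le> s" "s < s'" "s' < 1"
  shows "\<exists>f \<sigma>. holo_disc f (ball 0 1) \<and> f ` ball 0 1 \<subseteq> \<Omega> \<and> f 0 = w \<and> f (of_real \<sigma>) = z
    \<and> 0 \<le> \<sigma> \<and> \<sigma> < s'"
proof -
  have "caratheodory \<Omega> w z \<le> ereal (artanh s)"
    unfolding caratheodory_def
  proof (rule Sup_least, clarsimp simp: poincare_dist_0)
    fix F assume "holo_scalar F \<Omega>" "F ` \<Omega> \<subseteq> ball 0 1" "F w = 0"
    then have "cmod (F z) \<le> s" by (rule bd)
    then show "artanh (cmod (F z)) \<le> artanh s" using s by (intro artanh_real_mono) auto
  qed
  also have "ereal (artanh s) < ereal (artanh s')" using s by (simp add: artanh_real_strict_mono)
  finally have "lempert \<Omega> w z < ereal (artanh s')" unfolding eq .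
  then obtain \<sigma> f where f: "\<sigma> \<in> ball 0 1" "artanh (cmod \<sigma>) < artanh s'"
    "holo_disc f (ball 0 1)" "f ` ball 0 1 \<subseteq> \<Omega>" "f 0 = w" "f \<sigma> = z"
    unfolding lempert_def Inf_less_iff by (auto simp: poincare_dist_0)
  have \<sigma>: "cmod \<sigma> < s'"
    using artanh_real_mono[of s' "cmod \<sigma>"] f(1,2) s by (cases "cmod \<sigma> < s'") auto
  define u where "u = (if \<sigma> = 0 then 1 else \<sigma> / of_real (cmod \<sigma>))"
  have u: "cmod u = 1" "u * of_real (cmod \<sigma>) = \<sigma>" by (auto simp: u_def norm_divide)
  have ub: "(\<lambda>\<zeta>. u * \<zeta>) ` ball 0 1 \<subseteq> ball 0 1" using u(1) by (auto simp: norm_mult)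
  have "holo_disc (\<lambda>\<zeta>. f (u * \<zeta>)) (ball 0 1)"
    unfolding holo_disc_def
  proof
    fix i
    have "(\<lambda>\<zeta>. f \<zeta> $ i) holomorphic_on ball 0 1" using f(3) by (auto simp: holo_disc_def)
    then have "((\<lambda>\<zeta>. f \<zeta> $ i) \<circ> (\<lambda>\<zeta>. u * \<zeta>)) holomorphic_on ball 0 1"
      by (intro holomorphic_on_compose_gen[OF _ _ ub] holomorphic_intros)
    then show "(\<lambda>\<zeta>. f (u * \<zeta>) $ i) holomorphic_on ball 0 1" by (simp add: comp_def)
  qed
  moreover have "(\<lambda>\<zeta>. f (u * \<zeta>)) ` ball 0 1 \<subseteq> \<Omega>" using ub f(4) by blast
  ultimately show ?thesis
    using f u \<sigma> by (intro exI[of _ "\<lambda>\<zeta>. f (u * \<zeta>)"] exI[of _ "cmod \<sigma>"]) auto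
qed

text \<open>On the circle of radius \<open>r\<close> the bound reads \<open>1 / r ^ m\<close>; the
  maximum principle carries it inside, and \<open>r\<close> tends to 1.\<close>

lemma norm_le_one_of_power_mult:
  assumes k: "k holomorphic_on ball 0 1" and le: "\<And>z. cmod z < 1 \<Longrightarrow> cmod (z ^ m * k z) \<le> 1"
    and z: "cmod z < 1"
  shows "cmod (k z) \<le> 1"
proof -
  have *: "r ^ m * cmod (k z) \<le> 1" if r: "cmod z < r" "r < 1" for r
  proof -
    have r0: "0 < r" using r norm_ge_zero[of z] by linarith
    have "cmod (k z) \<le> 1 / r ^ m"
    proof (rule maximum_modulus_frontier[of k "cball 0 r"])
      show "k holomorphic_on interior (cball 0 r)"
        using r by (intro holomorphic_on_subset[OF k]) auto
      show "continuous_on (closure (cball 0 r)) k"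
        using r by (intro holomorphic_on_imp_continuous_on holomorphic_on_subset[OF k]) auto
      fix w assume "w \<in> frontier (cball 0 r :: complex set)"
      then have w: "cmod w = r" using r0 by (simp add: frontier_cball)
      then show "cmod (k w) \<le> 1 / r ^ m"
        using le[of w] r r0 by (simp add: norm_mult norm_power field_simps)
    qed (use r in auto)
    then show ?thesis using r0 by (simp add: field_simps)
  qed
  have "((\<lambda>r. r ^ m * cmod (k z)) \<longlongrightarrow> 1 ^ m * cmod (k z)) (at_left 1)"
    by (intro tendsto_intros)
  then have "1 ^ m * cmod (k z) \<le> 1"
  proof (rule tendsto_upperbound)
    show "\<forall>\<^sub>F r in at_left 1. r ^ m * cmod (k z) \<le> 1"
      by (rule eventually_at_leftI[of "cmod z"]) (use * z in auto)
  qed simp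
  then show ?thesis by simp
qed

text \<open>Schwarz's lemma twice: after rescaling, \<open>g\<close> is the square of the variable
  times a function bounded by 1.\<close>

lemma schwarz_second_order:
  assumes g: "g holomorphic_on ball a r" and le: "\<And>z. z \<in> ball a r \<Longrightarrow> cmod (g z) \<le> 1"
    and ga: "g a = 0" "deriv g a = 0" and r: "r > 0" and z: "z \<in> ball a r"
  shows "cmod (g z) \<le> (cmod (z - a) / r)\<^sup>2"
proof -
  define F where "F \<zeta> = g (a + of_real r * \<zeta>)" for \<zeta>
  have im: "(\<lambda>\<zeta>. a + of_real r * \<zeta>) ` ball 0 1 \<subseteq> ball a r"
    using r by (auto simp: dist_norm norm_mult)
  have F: "F holomorphic_on ball 0 1"
    unfolding F_def using holomorphic_on_compose_gen[OF _ g im] by (simp add: comp_def holomorphic_intros)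
  have "(F has_field_derivative deriv g a * of_real r) (at 0)"
  proof -
    have "(g has_field_derivative deriv g a) (at (a + of_real r * 0))"
      using holomorphic_derivI[OF g open_ball, of a] r by simp
    moreover have "((\<lambda>\<zeta>. a + of_real r * \<zeta>) has_field_derivative of_real r) (at 0)"
      by (auto intro!: derivative_eq_intros)
    ultimately show ?thesis unfolding F_def by (rule DERIV_chain2)
  qed
  then have dF: "deriv F 0 = 0" using ga by (simp add: DERIV_imp_deriv)
  have F0: "F 0 = 0" by (simp add: F_def ga)
  obtain h where h: "h holomorphic_on ball 0 1" "\<And>z. norm z < 1 \<Longrightarrow> F z = z * h z" "deriv F 0 = h 0"
    using Schwarz3[OF F F0] by metis
  obtain k where k: "k holomorphic_on ball 0 1" "\<And>z. norm z < 1 \<Longrightarrow> h z = z * k z"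
    using Schwarz3[OF h(1) h(3)[unfolded dF, symmetric]] by metis
  have Fk: "F \<zeta> = \<zeta> ^ 2 * k \<zeta>" if "cmod \<zeta> < 1" for \<zeta>
    using h(2)[OF that] k(2)[OF that] by (simp add: power2_eq_square)
  have k1: "cmod (k \<zeta>) \<le> 1" if "cmod \<zeta> < 1" for \<zeta>
  proof (rule norm_le_one_of_power_mult[OF k(1) _ that, of 2])
    fix \<zeta> :: complex assume \<zeta>: "cmod \<zeta> < 1"
    then have "a + of_real r * \<zeta> \<in> ball a r" by (intro subsetD[OF im imageI]) simp
    from le[OF this] show "cmod (\<zeta> ^ 2 * k \<zeta>) \<le> 1" using Fk[OF \<zeta>] by (simp add: F_def)
  qed
  define \<zeta> where "\<zeta> = (z - a) / of_real r"
  have \<zeta>: "cmod \<zeta> < 1" using z r by (simp add: \<zeta>_def norm_divide dist_norm norm_minus_commute)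
  have "cmod (g z) = cmod (F \<zeta>)" using r by (simp add: F_def \<zeta>_def)
  also have "\<dots> \<le> (cmod \<zeta>)\<^sup>2 * 1"
    unfolding Fk[OF \<zeta>] norm_mult norm_power using k1[OF \<zeta>] by (intro mult_left_mono) auto
  finally show ?thesis using r by (simp add: \<zeta>_def norm_divide)
qed

section \<open>The deviations of the branches from their mean\<close>

lemma sum_deviation_square:
  fixes x :: "complex ^ 'n"
  assumes m: "m = (\<Sum>j\<in>UNIV. x $ j) / of_nat CARD('n)" and le: "\<And>j. cmod (x $ j) \<le> 1"
  shows "(\<Sum>j\<in>UNIV. (cmod (x $ j - m))\<^sup>2) \<le> CARD('n) * (1 - (cmod m)\<^sup>2)"
proof -
  let ?n = "real CARD('n)"
  have s: "(\<Sum>j\<in>UNIV. x $ j) = of_nat CARD('n) * m" using m by simp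
  have "(\<Sum>j\<in>UNIV. (cmod (x $ j - m))\<^sup>2)
      = (\<Sum>j\<in>UNIV. (cmod (x $ j))\<^sup>2 - 2 * Re (cnj m * x $ j) + (cmod m)\<^sup>2)"
    unfolding cmod_power2 by (intro sum.cong refl) (simp add: power2_eq_square algebra_simps)
  also have "\<dots> = (\<Sum>j\<in>UNIV. (cmod (x $ j))\<^sup>2) - 2 * Re (cnj m * (\<Sum>j\<in>UNIV. x $ j)) + ?n * (cmod m)\<^sup>2"
    by (simp add: sum.distrib sum_subtractf sum_distrib_left Re_sum)
  also have "Re (cnj m * (\<Sum>j\<in>UNIV. x $ j)) = ?n * (cmod m)\<^sup>2"
    unfolding s cmod_power2 by (simp add: power2_eq_square algebra_simps)
  also have "(\<Sum>j\<in>UNIV. (cmod (x $ j))\<^sup>2) \<le> (\<Sum>j\<in>(UNIV :: 'n set). 1)"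
    by (intro sum_mono) (simp add: le power_le_one)
  finally show ?thesis by (simp add: algebra_simps)
qed

text \<open>A product of at least two coordinates contains two whose product is at most the sum of
  squares in modulus; the other factors are at most 2. There are at most \<open>2 ^ CARD('n)\<close>
  such products, whence the base 4.\<close>

lemma elem_sym_bound:
  fixes y :: "complex ^ 'n"
  assumes k: "k \<ge> 2" and le: "\<And>j. cmod (y $ j) \<le> 2"
  shows "cmod (elem_sym k y) \<le> 4 ^ CARD('n) * (\<Sum>j\<in>UNIV. (cmod (y $ j))\<^sup>2)"
proof -
  let ?s = "\<Sum>j\<in>UNIV. (cmod (y $ j))\<^sup>2"
  have P: "cmod (\<Prod>i\<in>S. y $ i) \<le> 2 ^ CARD('n) * ?s" if S: "card S = k" for S
  proof -
    obtain T where T: "T \<subseteq> S" "card T = 2"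
      using obtain_subset_with_card_n[of 2 S] k S by auto
    then obtain a b where ab: "a \<in> S" "b \<in> S" "a \<noteq> b"
      unfolding card_2_iff by auto
    have "(\<Prod>i\<in>S. y $ i) = y $ a * (y $ b * (\<Prod>i\<in>S - {a} - {b}. y $ i))"
      using ab by (simp add: prod.remove[symmetric] del: Diff_insert)
    then have "cmod (\<Prod>i\<in>S. y $ i) = (cmod (y $ a) * cmod (y $ b)) * (\<Prod>i\<in>S - {a} - {b}. cmod (y $ i))"
      by (simp add: norm_mult prod_norm mult.assoc)
    also have "\<dots> \<le> ?s * 2 ^ CARD('n)"
    proof (rule mult_mono)
      have "2 * (cmod (y $ a) * cmod (y $ b)) \<le> (cmod (y $ a))\<^sup>2 + (cmod (y $ b))\<^sup>2"
        using sum_squares_bound[of "cmod (y $ a)" "cmod (y $ b)"] by (simp add: mult.assoc)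
      also have "\<dots> = (\<Sum>j\<in>{a, b}. (cmod (y $ j))\<^sup>2)" using ab by simp
      also have "\<dots> \<le> ?s" by (intro sum_mono2) auto
      finally show "cmod (y $ a) * cmod (y $ b) \<le> ?s"
        using mult_nonneg_nonneg[OF norm_ge_zero norm_ge_zero, of "y $ a" "y $ b"] by linarith
      have "(\<Prod>i\<in>S - {a} - {b}. cmod (y $ i)) \<le> (\<Prod>i\<in>S - {a} - {b}. 2)"
        by (intro prod_mono) (simp add: le)
      also have "\<dots> \<le> 2 ^ CARD('n)"
        by (simp del: Diff_insert) (intro power_increasing card_mono; simp)
      finally show "(\<Prod>i\<in>S - {a} - {b}. cmod (y $ i)) \<le> 2 ^ CARD('n)" .
    qed (auto intro: sum_nonneg prod_nonneg)
    finally show ?thesis by (simp add: mult.commute)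
  qed
  have "cmod (elem_sym k y) \<le> (\<Sum>S\<in>{S :: 'n set. card S = k}. 2 ^ CARD('n) * ?s)"
    unfolding elem_sym_def by (rule sum_norm_le) (use P in auto)
  also have "\<dots> = real (card {S :: 'n set. card S = k}) * (2 ^ CARD('n) * ?s)" by simp
  also have "\<dots> \<le> 2 ^ CARD('n) * (2 ^ CARD('n) * ?s)"
  proof (rule mult_right_mono)
    have "card {S :: 'n set. card S = k} \<le> card (UNIV :: 'n set set)" by (intro card_mono) auto
    also have "\<dots> = 2 ^ CARD('n)" by (simp add: card_UNIV_set)
    finally show "real (card {S :: 'n set. card S = k}) \<le> 2 ^ CARD('n)"
      by (metis of_nat_le_iff of_nat_numeral of_nat_power)
  qed (simp add: sum_nonneg)
  also have "\<dots> = 4 ^ CARD('n) * ?s"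
    by (simp add: mult.assoc[symmetric] power_mult_distrib[symmetric])
  finally show ?thesis .
qed

text \<open>The branches need not be holomorphic, but the elementary symmetric polynomials of their
  deviations are. On the circle of radius \<open>r\<close> the variance bounds these from degree 2
  on, degree 1 vanishes by the choice of \<open>m\<close>, the maximum principle carries the bounds
  inside, and \<open>root_bound\<close> returns to the single branch.\<close>

lemma deviation_bound:
  fixes x :: "complex \<Rightarrow> complex ^ 'n" and B :: real
  assumes hol: "\<And>k. (\<lambda>\<zeta>. elem_sym k (\<chi> j. x \<zeta> $ j - m \<zeta>)) holomorphic_on ball 0 1"
    and le: "\<And>\<zeta> j. cmod \<zeta> < 1 \<Longrightarrow> cmod (x \<zeta> $ j) \<le> 1"
    and m: "\<And>\<zeta>. cmod \<zeta> < 1 \<Longrightarrow> m \<zeta> = (\<Sum>j\<in>UNIV. x \<zeta> $ j) / of_nat CARD('n)"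
    and r: "r < 1" and B: "\<And>\<zeta>. cmod \<zeta> = r \<Longrightarrow> 1 - (cmod (m \<zeta>))\<^sup>2 \<le> B" and z: "cmod z < r"
  shows "cmod (x z $ j - m z) ^ CARD('n) \<le> 2 ^ CARD('n) * (CARD('n) * (4 ^ CARD('n) * (CARD('n) * B)))"
proof -
  let ?n = "CARD('n)"
  define y where "y \<zeta> = (\<chi> j. x \<zeta> $ j - m \<zeta>)" for \<zeta>
  have r0: "0 < r" using z norm_ge_zero[of z] by linarith
  have m1: "cmod (m \<zeta>) \<le> 1" if "cmod \<zeta> < 1" for \<zeta>
  proof -
    have "cmod (\<Sum>j\<in>UNIV. x \<zeta> $ j) \<le> (\<Sum>j\<in>(UNIV :: 'n set). 1)"
      using le[OF that] by (intro order_trans[OF norm_sum] sum_mono) auto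
    then show ?thesis using m[OF that] by (simp add: norm_divide)
  qed
  have y2: "cmod (y \<zeta> $ j) \<le> 2" if "cmod \<zeta> < 1" for \<zeta> j
    using norm_triangle_ineq4[of "x \<zeta> $ j" "m \<zeta>"] le[OF that, of j] m1[OF that] by (simp add: y_def)
  have bd: "cmod (elem_sym k (y \<zeta>)) \<le> 4 ^ ?n * (?n * B)" if k: "k \<ge> 2" and \<zeta>: "cmod \<zeta> = r" for k \<zeta>
  proof -
    have \<zeta>1: "cmod \<zeta> < 1" using \<zeta> r by simp
    have "(\<Sum>j\<in>UNIV. (cmod (y \<zeta> $ j))\<^sup>2) \<le> ?n * (1 - (cmod (m \<zeta>))\<^sup>2)"
      unfolding y_def using sum_deviation_square[OF m[OF \<zeta>1] le[OF \<zeta>1]] by simp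
    also have "\<dots> \<le> ?n * B" using B[OF \<zeta>] by (intro mult_left_mono) auto
    finally have "4 ^ ?n * (\<Sum>j\<in>UNIV. (cmod (y \<zeta> $ j))\<^sup>2) \<le> 4 ^ ?n * (?n * B)"
      by (intro mult_left_mono) auto
    with elem_sym_bound[OF k y2[OF \<zeta>1]] show ?thesis by linarith
  qed
  have bd_in: "cmod (elem_sym k (y z)) \<le> 4 ^ ?n * (?n * B)" if k: "k \<ge> 2" for k
  proof (rule maximum_modulus_frontier[of "\<lambda>\<zeta>. elem_sym k (y \<zeta>)" "cball 0 r" _ z])
    have h: "(\<lambda>\<zeta>. elem_sym k (y \<zeta>)) holomorphic_on ball 0 1" unfolding y_def by (rule hol)
    show "(\<lambda>\<zeta>. elem_sym k (y \<zeta>)) holomorphic_on interior (cball 0 r)"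
      using r by (intro holomorphic_on_subset[OF h]) auto
    show "continuous_on (closure (cball 0 r)) (\<lambda>\<zeta>. elem_sym k (y \<zeta>))"
      using r by (intro holomorphic_on_imp_continuous_on holomorphic_on_subset[OF h]) auto
    fix w assume "w \<in> frontier (cball 0 r :: complex set)"
    then show "cmod (elem_sym k (y w)) \<le> 4 ^ ?n * (?n * B)"
      using r0 by (intro bd[OF k]) (simp add: frontier_cball)
  qed (use z in auto)
  have z1: "cmod z < 1" using z r by simp
  have B0: "0 \<le> B"
  proof -
    have "cmod (m (of_real r)) \<le> 1" using r r0 by (intro m1) simp
    then have "(cmod (m (of_real r)))\<^sup>2 \<le> 1" by (simp add: power_le_one)
    then show ?thesis using B[of "of_real r"] r0 by simp
  qed
  have "elem_sym 1 (y z) = 0"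
    unfolding elem_sym_1 y_def by (simp add: sum_subtractf m[OF z1])
  then have all: "cmod (elem_sym k (y z)) \<le> 4 ^ ?n * (?n * B)" if "k \<in> {1..?n}" for k
    using bd_in[of k] that B0 by (cases "k = 1") auto
  have "cmod (y z $ j) ^ ?n \<le> 2 ^ ?n * (\<Sum>k\<in>{1..?n}. cmod (elem_sym k (y z)))"
    by (rule root_bound) (use y2[OF z1] in auto)
  also have "\<dots> \<le> 2 ^ ?n * (\<Sum>k\<in>{1..?n}. 4 ^ ?n * (?n * B))"
    by (intro mult_left_mono sum_mono all) auto
  finally show ?thesis by (simp add: y_def)
qed

section \<open>Discs in the symmetric power and their branches\<close>

lemma holo_disc_symmetrization:
  assumes "\<And>k. (\<lambda>\<zeta>. elem_sym k (l \<zeta>)) holomorphic_on U"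
  shows "holo_disc (\<lambda>\<zeta>. symmetrization (l \<zeta> :: complex ^ 'n::{finite,linorder})) U"
  using assms by (simp add: holo_disc_def symmetrization_def)

lemma holo_disc_symmetrization_diag:
  assumes "c holomorphic_on U"
  shows "holo_disc (\<lambda>\<zeta>. symmetrization (\<chi> i. c \<zeta> :: complex ^ 'n::{finite,linorder})) U"
  by (rule holo_disc_symmetrization) (simp add: elem_sym_def, intro holomorphic_intros assms)

text \<open>The branches are chosen point by point, with no claim of continuity; holomorphy survives
  in the elementary symmetric polynomials because they are the coordinates of \<open>f\<close> or
  constant.\<close>

lemma symmetric_power_disc_lift:
  fixes f :: "complex \<Rightarrow> complex ^ 'n::{finite,linorder}"
  assumes f: "holo_disc f U" "f ` U \<subseteq> symmetric_power D"
  shows "\<exists>l. (\<forall>\<zeta>\<in>U. symmetrization (l \<zeta>) = f \<zeta> \<and> (\<forall>i. l \<zeta> $ i \<in> D)) \<and>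
    (\<forall>k. (\<lambda>\<zeta>. elem_sym k (l \<zeta>)) holomorphic_on U)"
proof -
  have "\<forall>\<zeta>\<in>U. \<exists>x. symmetrization x = f \<zeta> \<and> (\<forall>i. x $ i \<in> D)"
    using f(2) unfolding symmetric_power_def by fastforce
  then obtain l where l: "\<And>\<zeta>. \<zeta> \<in> U \<Longrightarrow> symmetrization (l \<zeta>) = f \<zeta> \<and> (\<forall>i. l \<zeta> $ i \<in> D)"
    by metis
  have "(\<lambda>\<zeta>. elem_sym k (l \<zeta>)) holomorphic_on U" for k
  proof -
    consider "k = 0" | "k > CARD('n)" | "k \<in> {1..CARD('n)}" by force
    then show ?thesis
    proof cases
      case 3
      then obtain i :: 'n where i: "k = card {..i}"
        unfolding range_card_atMost[symmetric] by auto
      have "(\<lambda>\<zeta>. f \<zeta> $ i) holomorphic_on U" using f(1) by (simp add: holo_disc_def)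
      then show ?thesis
      proof (rule holomorphic_transform)
        fix \<zeta> assume "\<zeta> \<in> U"
        then have "f \<zeta> $ i = symmetrization (l \<zeta>) $ i" using l by simp
        then show "f \<zeta> $ i = elem_sym k (l \<zeta>)" by (simp add: symmetrization_def i)
      qed
    qed (simp_all add: elem_sym_gt_card)
  qed
  with l show ?thesis by blast
qed

lemma eq_const_of_symmetrization_eq:
  fixes x :: "complex ^ 'n::{finite,linorder}"
  assumes "symmetrization x = symmetrization (\<chi> i. c)"
  shows "x $ j = c"
proof -
  have "range (($) x) = range (($) (\<chi> i. c :: complex ^ 'n::{finite,linorder}))"
    using assms unfolding symmetrization_eq_iff by (intro range_eq_of_elem_sym_eq) auto
  then show ?thesis by force
qed

section \<open>Normal families, extremal functions and sequences of discs\<close>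

lemma Montel_bounded:
  fixes F :: "nat \<Rightarrow> complex \<Rightarrow> complex"
  assumes S: "open S" and hol: "\<And>k. F k holomorphic_on S" and bd: "\<And>k z. z \<in> S \<Longrightarrow> cmod (F k z) \<le> B"
  obtains g r where "g holomorphic_on S" "strict_mono (r :: nat \<Rightarrow> nat)"
    "\<And>x. x \<in> S \<Longrightarrow> (\<lambda>n. F (r n) x) \<longlonglongrightarrow> g x"
    "\<And>K. compact K \<Longrightarrow> K \<subseteq> S \<Longrightarrow> uniform_limit K (\<lambda>n. F (r n)) g sequentially"
proof -
  let ?H = "{h. h holomorphic_on S \<and> (\<forall>z\<in>S. cmod (h z) \<le> B)}"
  show ?thesis
  proof (rule Montel[OF S, of ?H F])
    show "\<exists>B. \<forall>h\<in>?H. \<forall>z\<in>K. cmod (h z) \<le> B" if "compact K" "K \<subseteq> S" for K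
      using that by (intro exI[of _ B]) auto
    fix g r assume *: "g holomorphic_on S" "strict_mono (r :: nat \<Rightarrow> nat)"
      "\<And>x. x \<in> S \<Longrightarrow> (\<lambda>n. F (r n) x) \<longlonglongrightarrow> g x"
      "\<And>K. compact K \<Longrightarrow> K \<subseteq> S \<Longrightarrow> uniform_limit K (F \<circ> r) g sequentially"
    show ?thesis by (rule that[OF *(1-3)]) (use *(4) in \<open>auto simp: comp_def\<close>)
  qed (use hol bd in auto)
qed

lemma norm_less_one_of_le_one:
  assumes f: "f holomorphic_on S" and S: "open S" "connected S"
    and le: "\<And>z. z \<in> S \<Longrightarrow> cmod (f z) \<le> 1" and a: "a \<in> S" "cmod (f a) < 1" and z: "z \<in> S"
  shows "cmod (f z) < 1"
proof (rule ccontr)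
  assume "\<not> ?thesis"
  then have fz: "cmod (f z) = 1" using le[OF z] by simp
  have "f constant_on S"
    by (rule maximum_modulus_principle[OF f S S(1) _ z]) (use le fz in auto)
  then have "f a = f z" using a(1) z unfolding constant_on_def by metis
  then show False using a(2) fz by simp
qed

text \<open>A maximising sequence has a convergent subsequence by Montel's theorem. The limit is
  bounded by 1 and vanishes at \<open>a\<close>, so the maximum principle keeps it inside the open
  disc.\<close>

lemma caratheodory_extremal_exists:
  assumes D: "open D" "connected D" and ab: "a \<in> D" "b \<in> D"
  shows "\<exists>g. g holomorphic_on D \<and> g ` D \<subseteq> ball 0 1 \<and> g a = 0 \<and>
    (\<forall>F. F holomorphic_on D \<longrightarrow> F ` D \<subseteq> ball 0 1 \<longrightarrow> F a = 0 \<longrightarrow> cmod (F b) \<le> cmod (g b))"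
proof -
  define H where "H = {F. F holomorphic_on D \<and> F ` D \<subseteq> ball 0 1 \<and> F a = 0}"
  define s where "s = (SUP F\<in>H. cmod (F b))"
  have bdd: "bdd_above ((\<lambda>F. cmod (F b)) ` H)"
    by (rule bdd_aboveI[of _ 1]) (use ab in \<open>force simp: H_def\<close>)
  have ne: "H \<noteq> {}" unfolding H_def by (auto intro!: exI[of _ "\<lambda>_. 0"])
  have le: "cmod (F b) \<le> s" if "F \<in> H" for F
    unfolding s_def by (rule cSUP_upper[OF that bdd])
  have "\<exists>F\<in>H. s - 1 / Suc k < cmod (F b)" for k
    using less_cSUP_iff[OF ne bdd, of "s - 1 / Suc k"] by (simp add: s_def)
  then obtain F where F: "\<And>k. F k \<in> H" "\<And>k. s - 1 / Suc k < cmod (F k b)" by metis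
  obtain g r where g: "g holomorphic_on D" "strict_mono (r :: nat \<Rightarrow> nat)"
    "\<And>x. x \<in> D \<Longrightarrow> (\<lambda>n. F (r n) x) \<longlonglongrightarrow> g x"
  proof (rule Montel_bounded[OF D(1), of F 1])
    show "F k holomorphic_on D" for k using F(1) by (simp add: H_def)
    show "cmod (F k z) \<le> 1" if "z \<in> D" for k z using F(1)[of k] that by (force simp: H_def)
  qed blast
  have ga: "g a = 0"
    using LIMSEQ_unique[OF g(3)[OF ab(1)], of 0] F(1) by (simp add: H_def)
  have g1: "cmod (g z) \<le> 1" if "z \<in> D" for z
  proof (rule tendsto_upperbound[OF tendsto_norm[OF g(3)[OF that]]])
    show "\<forall>\<^sub>F n in sequentially. cmod (F (r n) z) \<le> 1"
    proof (intro always_eventually allI)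
      show "cmod (F (r n) z) \<le> 1" for n using F(1)[of "r n"] that by (force simp: H_def)
    qed
  qed simp
  have "cmod (g z) < 1" if "z \<in> D" for z
    by (rule norm_less_one_of_le_one[OF g(1) D g1 ab(1) _ that]) (use ga in auto)
  then have im: "g ` D \<subseteq> ball 0 1" by auto
  have sg: "s \<le> cmod (g b)"
  proof (rule tendsto_le[OF _ tendsto_norm[OF g(3)[OF ab(2)]]])
    have "(\<lambda>k. s - 1 / Suc k) \<longlonglongrightarrow> s - 0"
      by (intro tendsto_intros LIMSEQ_Suc lim_1_over_n)
    from LIMSEQ_subseq_LIMSEQ[OF this g(2)] show "(\<lambda>n. s - 1 / Suc (r n)) \<longlonglongrightarrow> s"
      by (simp add: comp_def)
    show "\<forall>\<^sub>F n in sequentially. s - 1 / Suc (r n) \<le> cmod (F (r n) b)"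
      using F(2) by (intro always_eventually allI less_imp_le)
  qed simp
  have "cmod (F b) \<le> cmod (g b)" if "F holomorphic_on D" "F ` D \<subseteq> ball 0 1" "F a = 0" for F
    using le[of F] sg that by (simp add: H_def)
  then show ?thesis using g(1) ga im by blast
qed

text \<open>Near the unit circle the limit of the means has modulus almost 1, which leaves almost no
  room for variance; \<open>deviation_bound\<close> transports this to \<open>z\<close>.\<close>

lemma deviation_tendsto_0:
  fixes x :: "nat \<Rightarrow> complex \<Rightarrow> complex ^ 'n"
  assumes hol: "\<And>k i. (\<lambda>\<zeta>. elem_sym i (\<chi> j. x k \<zeta> $ j - m k \<zeta>)) holomorphic_on ball 0 1"
    and le: "\<And>k \<zeta> j. cmod \<zeta> < 1 \<Longrightarrow> cmod (x k \<zeta> $ j) \<le> 1"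
    and m: "\<And>k \<zeta>. cmod \<zeta> < 1 \<Longrightarrow> m k \<zeta> = (\<Sum>j\<in>UNIV. x k \<zeta> $ j) / of_nat CARD('n)"
    and lim: "\<And>K. compact K \<Longrightarrow> K \<subseteq> ball 0 1 \<Longrightarrow> uniform_limit K m (\<lambda>\<zeta>. \<alpha> * \<zeta>) sequentially"
    and \<alpha>: "cmod \<alpha> = 1" and z: "cmod z < 1"
  shows "(\<lambda>k. x k z $ j - m k z) \<longlonglongrightarrow> 0"
proof -
  let ?n = "CARD('n)"
  define C where "C B = 2 ^ ?n * (?n * (4 ^ ?n * (?n * B)))" for B :: real
  have "(\<lambda>k. cmod (x k z $ j - m k z) ^ ?n) \<longlonglongrightarrow> 0"
  proof (rule order_tendstoI)
    fix e :: real assume "e < 0"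
    then show "\<forall>\<^sub>F k in sequentially. e < cmod (x k z $ j - m k z) ^ ?n"
      by (intro always_eventually allI) (rule less_le_trans, auto)
  next
    fix e :: real assume e: "0 < e"
    have "((\<lambda>t. C (1 - t\<^sup>2)) \<longlongrightarrow> C (1 - 1\<^sup>2)) (at_left 1)"
      unfolding C_def by (intro tendsto_intros)
    then have "\<forall>\<^sub>F t in at_left 1. C (1 - t\<^sup>2) < e"
      by (rule order_tendstoD) (simp add: C_def e)
    moreover have "\<forall>\<^sub>F t in at_left (1::real). cmod z < t \<and> t < 1"
      by (rule eventually_at_leftI[of "cmod z"]) (use z in auto)
    ultimately have "\<forall>\<^sub>F t in at_left (1::real). C (1 - t\<^sup>2) < e \<and> cmod z < t \<and> t < 1"
      by (rule eventually_conj)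
    from eventually_happens'[OF trivial_limit_at_left_real this]
    obtain t where t': "C (1 - t\<^sup>2) < e" "cmod z < t" "t < 1" by auto
    have t: "C (1 - t\<^sup>2) < e" "0 < t" "cmod z < t" "t < 1"
      using t' le_less_trans[OF norm_ge_zero t'(2)] by auto
    \<comment> \<open>Once \<open>m k\<close> is within \<open>r - t\<close> of
      \<open>\<alpha> * \<zeta>\<close> on the circle of radius \<open>r\<close>, its modulus there
      is at least \<open>t\<close>.\<close>
    define r where "r = (1 + t) / 2"
    have r: "t < r" "r < 1" using t by (auto simp: r_def)
    have "uniform_limit (sphere 0 r) m (\<lambda>\<zeta>. \<alpha> * \<zeta>) sequentially"
      using r by (intro lim) auto
    then have "\<forall>\<^sub>F k in sequentially. \<forall>\<zeta>\<in>sphere 0 r. dist (m k \<zeta>) (\<alpha> * \<zeta>) < r - t"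
      using r by (intro uniform_limitD) auto
    then show "\<forall>\<^sub>F k in sequentially. cmod (x k z $ j - m k z) ^ ?n < e"
    proof (rule eventually_mono)
      fix k assume k: "\<forall>\<zeta>\<in>sphere 0 r. dist (m k \<zeta>) (\<alpha> * \<zeta>) < r - t"
      have "cmod (x k z $ j - m k z) ^ ?n \<le> C (1 - t\<^sup>2)"
        unfolding C_def
      proof (rule deviation_bound[OF hol le m r(2)])
        fix \<zeta> :: complex assume \<zeta>: "cmod \<zeta> = r"
        have "cmod (\<alpha> * \<zeta>) - cmod (m k \<zeta>) \<le> dist (m k \<zeta>) (\<alpha> * \<zeta>)"
          by (metis dist_norm norm_minus_commute norm_triangle_ineq2)
        moreover have "dist (m k \<zeta>) (\<alpha> * \<zeta>) < r - t" using k \<zeta> by simp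
        ultimately have "t \<le> cmod (m k \<zeta>)" using \<alpha> \<zeta> by (simp add: norm_mult)
        then have "t\<^sup>2 \<le> (cmod (m k \<zeta>))\<^sup>2" using t(2) by (intro power_mono) auto
        then show "1 - (cmod (m k \<zeta>))\<^sup>2 \<le> 1 - t\<^sup>2" by simp
      qed (use t r in auto)
      then show "cmod (x k z $ j - m k z) ^ ?n < e" using t(1) by simp
    qed
  qed
  then have "(\<lambda>k. root ?n (cmod (x k z $ j - m k z) ^ ?n)) \<longlonglongrightarrow> root ?n 0"
    by (rule tendsto_real_root)
  then show ?thesis by (simp add: real_root_power_cancel tendsto_norm_zero_iff)
qed

lemma elem_sym_crude_bound:
  fixes y :: "complex ^ 'n"
  assumes B: "B \<ge> 1" and le: "\<And>j. cmod (y $ j) \<le> B"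
  shows "cmod (elem_sym k y) \<le> (2 * B) ^ CARD('n)"
proof -
  have P: "cmod (\<Prod>i\<in>S. y $ i) \<le> B ^ CARD('n)" for S
  proof -
    have "cmod (\<Prod>i\<in>S. y $ i) \<le> (\<Prod>i\<in>S. B)"
      unfolding prod_norm[symmetric] by (intro prod_mono) (simp add: le)
    also have "\<dots> \<le> B ^ CARD('n)"
      using B by simp (intro power_increasing card_mono; simp)
    finally show ?thesis .
  qed
  have "cmod (elem_sym k y) \<le> (\<Sum>S\<in>{S :: 'n set. card S = k}. B ^ CARD('n))"
    unfolding elem_sym_def by (rule sum_norm_le) (rule P)
  also have "\<dots> \<le> (\<Sum>S\<in>(UNIV :: 'n set set). B ^ CARD('n))"
    using B by (intro sum_mono2) auto
  also have "\<dots> = (2 * B) ^ CARD('n)"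
    by (simp add: card_UNIV_set power_mult_distrib)
  finally show ?thesis .
qed

text \<open>The radius \<open>d\<close> is common to all \<open>l\<close>, so it serves a whole
  sequence of discs. The elementary symmetric polynomials of the differences from \<open>a\<close>
  vanish at 0 in positive degree and are bounded by \<open>C\<close>; Schwarz's lemma makes them
  small near 0, with \<open>2 * C\<close> supplying the strict bound it asks for, and
  \<open>root_bound\<close> concludes.\<close>

lemma roots_near_uniform:
  assumes D: "bounded D" and r: "r > 0"
  shows "\<exists>d>0. \<forall>l :: complex \<Rightarrow> complex ^ 'n.
    (\<forall>k. (\<lambda>\<zeta>. elem_sym k (\<chi> j. l \<zeta> $ j - a)) holomorphic_on ball 0 1) \<longrightarrow>
    (\<forall>\<zeta>\<in>ball 0 1. \<forall>j. l \<zeta> $ j \<in> D) \<longrightarrow> (\<forall>j. l 0 $ j = a) \<longrightarrow>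
    (\<forall>\<zeta>. cmod \<zeta> < d \<longrightarrow> (\<forall>j. dist (l \<zeta> $ j) a < r))"
proof -
  let ?n = "CARD('n)"
  obtain M where M: "\<And>t. t \<in> D \<Longrightarrow> cmod t \<le> M"
    using D unfolding bounded_iff by blast
  define B where "B = max 1 (M + cmod a)"
  define C where "C = (2 * B) ^ ?n"
  have B: "B \<ge> 1" by (simp add: B_def)
  then have C: "C > 0" by (simp add: C_def)
  define E where "E = B ^ ?n * (?n * (2 * C))"
  have E: "E > 0" using B C by (simp add: E_def)
  define d where "d = min 1 (r ^ ?n / E)"
  have d: "d > 0" "d \<le> 1" "d * E \<le> r ^ ?n"
    using E r by (auto simp: d_def field_simps min_def)
  show ?thesis
  proof (intro exI[of _ d] conjI allI impI d(1))
    fix l :: "complex \<Rightarrow> complex ^ 'n" and \<zeta> j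
    assume hol: "\<forall>k. (\<lambda>\<zeta>. elem_sym k (\<chi> j. l \<zeta> $ j - a)) holomorphic_on ball 0 1"
      and lD: "\<forall>\<zeta>\<in>ball 0 1. \<forall>j. l \<zeta> $ j \<in> D" and l0: "\<forall>j. l 0 $ j = a" and \<zeta>: "cmod \<zeta> < d"
    have \<zeta>1: "cmod \<zeta> < 1" using \<zeta> d by simp
    define y where "y \<zeta> = (\<chi> j. l \<zeta> $ j - a)" for \<zeta>
    have yB: "cmod (y \<zeta> $ j) \<le> B" if "cmod \<zeta> < 1" for \<zeta> j
      using norm_triangle_ineq4[of "l \<zeta> $ j" a] M[of "l \<zeta> $ j"] lD that by (fastforce simp: y_def B_def)
    have e: "cmod (elem_sym k (y \<zeta>)) \<le> cmod \<zeta> * (2 * C)" if k: "k \<in> {1..?n}" for k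
    proof -
      have "cmod ((\<lambda>\<zeta>. elem_sym k (y \<zeta>) / of_real (2 * C)) \<zeta>) \<le> cmod \<zeta>"
      proof (rule Schwarz_Lemma(1)[OF _ _ _ \<zeta>1])
        show "(\<lambda>\<zeta>. elem_sym k (y \<zeta>) / of_real (2 * C)) holomorphic_on ball 0 1"
          using hol C unfolding y_def by (intro holomorphic_intros) auto
        have "S \<noteq> {}" if "card S = k" for S :: "'n set" using that k by auto
        then show "elem_sym k (y 0) / of_real (2 * C) = 0"
          using l0 by (auto simp: elem_sym_def y_def intro!: sum.neutral)
        show "cmod (elem_sym k (y z) / of_real (2 * C)) < 1" if "cmod z < 1" for z
          using elem_sym_crude_bound[OF B yB[OF that], of k] C unfolding C_def[symmetric] by (simp add: norm_divide)
      qed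
      then show ?thesis using C by (simp add: norm_divide field_simps)
    qed
    have "cmod (y \<zeta> $ j) ^ ?n \<le> B ^ ?n * (\<Sum>k\<in>{1..?n}. cmod (elem_sym k (y \<zeta>)))"
      by (rule root_bound[OF B yB[OF \<zeta>1]])
    also have "\<dots> \<le> B ^ ?n * (\<Sum>k\<in>{1..?n}. cmod \<zeta> * (2 * C))"
      using B by (intro mult_left_mono sum_mono e) auto
    also have "\<dots> = cmod \<zeta> * E" by (simp add: E_def)
    also have "\<dots> < d * E" using \<zeta> E by simp
    also have "\<dots> \<le> r ^ ?n" by (rule d(3))
    finally have "cmod (y \<zeta> $ j) < r" by (rule power_less_imp_less_base) (use r in auto)
    then show "dist (l \<zeta> $ j) a < r" by (simp add: y_def dist_norm)
  qed
qed

section \<open>The domain is a disc\<close>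

text \<open>On the diagonal a competitor \<open>F\<close> is a function on \<open>D\<close>, so the
  bound \<open>s\<close> passes to the symmetric power. A diagonal point has all its branches equal,
  which fixes the lift at 0 and at \<open>\<sigma>\<close>.\<close>

lemma diagonal_lempert_disc:
  fixes D :: "complex set" and a b :: complex
  defines "\<Omega> \<equiv> symmetric_power D :: (complex ^ 'n::{finite,linorder}) set"
  assumes eq: "\<forall>w\<in>\<Omega>. \<forall>z\<in>\<Omega>. caratheodory \<Omega> w z = lempert \<Omega> w z"
    and D: "open D" "a \<in> D" "b \<in> D"
    and ext: "\<And>F. F holomorphic_on D \<Longrightarrow> F ` D \<subseteq> ball 0 1 \<Longrightarrow> F a = 0 \<Longrightarrow> cmod (F b) \<le> s"
    and s: "0 \<le> s" "s < s'" "s' < 1"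
  shows "\<exists>(l :: complex \<Rightarrow> complex ^ 'n::{finite,linorder}) \<sigma>. (\<forall>k. (\<lambda>\<zeta>. elem_sym k (l \<zeta>)) holomorphic_on ball 0 1) \<and>
    (\<forall>\<zeta>\<in>ball 0 1. \<forall>j. l \<zeta> $ j \<in> D) \<and> (\<forall>j. l 0 $ j = a) \<and> (\<forall>j. l (of_real \<sigma>) $ j = b) \<and>
    0 \<le> \<sigma> \<and> \<sigma> < s'"
proof -
  let ?d = "\<lambda>t. symmetrization (\<chi> i. t) :: complex ^ 'n::{finite,linorder}"
  have d: "?d t \<in> \<Omega>" if "t \<in> D" for t
    using that by (auto simp: \<Omega>_def symmetric_power_def)
  have "\<exists>f \<sigma>. holo_disc f (ball 0 1) \<and> f ` ball 0 1 \<subseteq> \<Omega> \<and> f 0 = ?d a \<and> f (of_real \<sigma>) = ?d b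
    \<and> 0 \<le> \<sigma> \<and> \<sigma> < s'"
  proof (rule lempert_disc_exists[OF _ _ s])
    show "caratheodory \<Omega> (?d a) (?d b) = lempert \<Omega> (?d a) (?d b)"
      using eq d D by blast
    fix F assume F: "holo_scalar F \<Omega>" "F ` \<Omega> \<subseteq> ball 0 1" "F (?d a) = 0"
    have hd: "holo_disc ?d D" by (rule holo_disc_symmetrization_diag) (rule holomorphic_on_ident)
    have im: "?d ` D \<subseteq> \<Omega>" using d by blast
    show "cmod (F (?d b)) \<le> s"
    proof (rule ext[of "\<lambda>t. F (?d t)"])
      show "(\<lambda>t. F (?d t)) holomorphic_on D"
        by (rule holo_scalar_compose_holo_disc[OF F(1) hd D(1) im])
    qed (use F im in auto)
  qed
  then obtain f \<sigma> where f: "holo_disc f (ball 0 1)" "f ` ball 0 1 \<subseteq> \<Omega>" "f 0 = ?d a"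
    "f (of_real \<sigma>) = ?d b" "0 \<le> \<sigma>" "\<sigma> < s'" by blast
  obtain l where l: "\<forall>\<zeta>\<in>ball 0 1. symmetrization (l \<zeta>) = f \<zeta> \<and> (\<forall>i. l \<zeta> $ i \<in> D)"
    "\<forall>k. (\<lambda>\<zeta>. elem_sym k (l \<zeta>)) holomorphic_on ball 0 1"
    using symmetric_power_disc_lift[OF f(1) f(2)[unfolded \<Omega>_def]] by blast
  have "l 0 $ j = a" for j
    by (rule eq_const_of_symmetrization_eq) (use l(1) f(3) in simp)
  moreover have "l (of_real \<sigma>) $ j = b" for j
    by (rule eq_const_of_symmetrization_eq) (use l(1) f s in simp)
  ultimately show ?thesis using l f by blast
qed

text \<open>If \<open>deriv g a\<close> vanished, \<open>g b\<close> would be quadratically small in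
  the distance of \<open>a\<close> and \<open>b\<close>, while the scaled coordinate
  \<open>(z - a) / R\<close> is a competitor of linear size.\<close>

lemma extremal_with_nonzero_deriv:
  assumes D: "open D" "connected D" "D \<noteq> {}" "bounded D"
  shows "\<exists>a b g. a \<in> D \<and> b \<in> D \<and> g holomorphic_on D \<and> g ` D \<subseteq> ball 0 1 \<and> g a = 0 \<and> deriv g a \<noteq> 0 \<and>
    g b \<noteq> 0 \<and>
    (\<forall>F. F holomorphic_on D \<longrightarrow> F ` D \<subseteq> ball 0 1 \<longrightarrow> F a = 0 \<longrightarrow> cmod (F b) \<le> cmod (g b))"
proof -
  obtain a where a: "a \<in> D" using D by blast
  obtain r where r: "r > 0" "ball a r \<subseteq> D" using D(1) a open_contains_ball by blast
  obtain R where R: "R > 0" "D \<subseteq> ball a R" using bounded_subset_ballD[OF D(4), of a] by blast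
  \<comment> \<open>Small enough for \<open>(d / r)\<^sup>2 < d / R\<close>, that is, for the
    quadratic bound to lie below the linear one.\<close>
  define d where "d = min (r / 2) (r\<^sup>2 / (2 * R))"
  have d: "0 < d" "d < r" using r R by (auto simp: d_def)
  have "d \<le> r\<^sup>2 / (2 * R)" by (simp add: d_def)
  also have "\<dots> < r\<^sup>2 / R" using r R by (simp add: divide_strict_left_mono)
  finally have "(d / r)\<^sup>2 < d / R" using d r R by (simp add: power2_eq_square field_simps)
  define b where "b = a + of_real d"
  have ba: "cmod (b - a) = d" "b \<in> ball a r" using d by (auto simp: b_def dist_norm)
  then have b: "b \<in> D" using r by auto
  obtain g where g: "g holomorphic_on D" "g ` D \<subseteq> ball 0 1" "g a = 0"
    "\<And>F. F holomorphic_on D \<Longrightarrow> F ` D \<subseteq> ball 0 1 \<Longrightarrow> F a = 0 \<Longrightarrow> cmod (F b) \<le> cmod (g b)"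
    using caratheodory_extremal_exists[OF D(1,2) a b] by blast
  have "cmod ((\<lambda>z. (z - a) / of_real R) b) \<le> cmod (g b)"
  proof (rule g(4))
    show "(\<lambda>z. (z - a) / of_real R) ` D \<subseteq> ball 0 1"
      using R by (auto simp: norm_divide dist_norm norm_minus_commute)
  qed (use R in \<open>auto intro!: holomorphic_intros\<close>)
  then have gb: "d / R \<le> cmod (g b)" using R ba by (simp add: norm_divide)
  have "deriv g a \<noteq> 0"
  proof
    assume g': "deriv g a = 0"
    have "cmod (g b) \<le> (cmod (b - a) / r)\<^sup>2"
    proof (rule schwarz_second_order[OF holomorphic_on_subset[OF g(1) r(2)] _ g(3) g' r(1) ba(2)])
      show "cmod (g z) \<le> 1" if "z \<in> ball a r" for z
        using g(2) r(2) that by (force simp: image_subset_iff)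
    qed
    then show False using gb ba \<open>(d / r)\<^sup>2 < d / R\<close> by simp
  qed
  moreover have "0 < d / R" using d R by simp
  then have "g b \<noteq> 0" using gb by auto
  ultimately show ?thesis using a b g by blast
qed

lemma uniform_limit_diagonal:
  fixes m :: "nat \<Rightarrow> complex \<Rightarrow> complex"
  assumes u: "uniform_limit K m \<phi> sequentially" and c: "continuous_on K \<phi>"
    and x: "\<And>k. x k \<in> K" "x \<longlonglongrightarrow> y" "y \<in> K"
  shows "(\<lambda>k. m k (x k)) \<longlonglongrightarrow> \<phi> y"
proof -
  have "(\<lambda>k. \<phi> (x k)) \<longlonglongrightarrow> \<phi> y"
    by (rule continuous_on_tendsto_compose[OF c x(2,3)]) (use x in auto)
  moreover have "(\<lambda>k. m k (x k) - \<phi> (x k)) \<longlonglongrightarrow> 0"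
  proof (rule tendstoI)
    fix e :: real assume "e > 0"
    from uniform_limitD[OF u this] show "\<forall>\<^sub>F k in sequentially. dist (m k (x k) - \<phi> (x k)) 0 < e"
      by (rule eventually_mono) (use x in \<open>auto simp: dist_norm\<close>)
  qed
  ultimately have "(\<lambda>k. (m k (x k) - \<phi> (x k)) + \<phi> (x k)) \<longlonglongrightarrow> 0 + \<phi> y" by (intro tendsto_add)
  then show ?thesis by simp
qed

text \<open>The means of \<open>g\<close> over the branches send 0 to 0 and
  \<open>\<sigma> k\<close> to \<open>g b\<close>. In the limit equality holds in Schwarz's lemma at
  \<open>cmod (g b)\<close>, so a limit of the means is a rotation, and
  \<open>deviation_tendsto_0\<close> forces every branch onto it.\<close>

lemma extremal_branches_coalesce:
  fixes l :: "nat \<Rightarrow> complex \<Rightarrow> complex ^ 'n" and D :: "complex set"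
  assumes D: "open D" "bounded D" and g: "g holomorphic_on D" "g ` D \<subseteq> ball 0 1" "g a = 0" "g b \<noteq> 0"
    and l: "\<And>k i. (\<lambda>\<zeta>. elem_sym i (l k \<zeta>)) holomorphic_on ball 0 1"
      "\<And>k \<zeta> j. \<zeta> \<in> ball 0 1 \<Longrightarrow> l k \<zeta> $ j \<in> D" "\<And>k j. l k 0 $ j = a"
      "\<And>k j. l k (of_real (\<sigma> k)) $ j = b"
    and \<sigma>: "\<And>k. 0 \<le> \<sigma> k" "\<And>k. \<sigma> k \<le> s'" "s' < 1" "\<sigma> \<longlonglongrightarrow> cmod (g b)"
  shows "\<exists>\<alpha> r. cmod \<alpha> = 1 \<and> strict_mono (r :: nat \<Rightarrow> nat) \<and>
    (\<forall>\<zeta>\<in>ball 0 1. \<forall>j. (\<lambda>k. g (l (r k) \<zeta> $ j)) \<longlonglongrightarrow> \<alpha> * \<zeta>)"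
proof -
  let ?n = "CARD('n)"
  define m where "m k \<zeta> = (\<Sum>j\<in>UNIV. g (l k \<zeta> $ j)) / of_nat ?n" for k \<zeta>
  have g1: "cmod (g (l k \<zeta> $ j)) < 1" if "\<zeta> \<in> ball 0 1" for k \<zeta> j
    using g(2) l(2)[OF that, of k j] by (force simp: image_subset_iff)
  have mh: "m k holomorphic_on ball 0 1" for k
    unfolding m_def
    by (intro holomorphic_intros sum_compose_holomorphic[OF open_ball l(1,2) D(2,1) g(1)]) auto
  have m1: "cmod (m k \<zeta>) \<le> 1" if "\<zeta> \<in> ball 0 1" for k \<zeta>
  proof -
    have "cmod (\<Sum>j\<in>UNIV. g (l k \<zeta> $ j)) \<le> (\<Sum>j\<in>(UNIV :: 'n set). 1)"
      by (rule sum_norm_le) (use g1[OF that] less_imp_le in blast)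
    then show ?thesis by (simp add: m_def norm_divide)
  qed
  have m0: "m k 0 = 0" for k by (simp add: m_def l(3) g(3))
  have m\<sigma>: "m k (of_real (\<sigma> k)) = g b" for k by (simp add: m_def l(4))
  obtain \<phi> r where \<phi>: "\<phi> holomorphic_on ball 0 1" "strict_mono (r :: nat \<Rightarrow> nat)"
    "\<And>x. x \<in> ball 0 1 \<Longrightarrow> (\<lambda>n. m (r n) x) \<longlonglongrightarrow> \<phi> x"
    "\<And>K. compact K \<Longrightarrow> K \<subseteq> ball 0 1 \<Longrightarrow> uniform_limit K (\<lambda>n. m (r n)) \<phi> sequentially"
    by (rule Montel_bounded[of "ball 0 1" m 1, OF open_ball mh m1]) blast+
  have \<phi>0: "\<phi> 0 = 0"
    using LIMSEQ_unique[OF \<phi>(3)[of 0], of 0] m0 by simp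
  have \<phi>1: "cmod (\<phi> \<zeta>) \<le> 1" if "\<zeta> \<in> ball 0 1" for \<zeta>
    by (rule tendsto_upperbound[OF tendsto_norm[OF \<phi>(3)[OF that]]])
       (use m1[OF that] in \<open>auto intro!: always_eventually\<close>)
  have \<phi>lt: "cmod (\<phi> \<zeta>) < 1" if "\<zeta> \<in> ball 0 1" for \<zeta>
    by (rule norm_less_one_of_le_one[OF \<phi>(1) open_ball connected_ball \<phi>1 _ _ that, of 0])
       (use \<phi>0 in auto)
  have s': "cmod (g b) \<le> s'" by (rule LIMSEQ_le_const2[OF \<sigma>(4)]) (use \<sigma>(2) in auto)
  \<comment> \<open>The point where the mean takes the value \<open>g b\<close> moves with
    \<open>k\<close>; uniform convergence on a closed disc containing all these points takes care of
    this.\<close>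
  have "(\<lambda>k. m (r k) (of_real (\<sigma> (r k)))) \<longlonglongrightarrow> \<phi> (of_real (cmod (g b)))"
  proof (rule uniform_limit_diagonal[where K = "cball 0 s'" and m = "\<lambda>k. m (r k)"
        and x = "\<lambda>k. of_real (\<sigma> (r k))" and \<phi> = \<phi> and y = "of_real (cmod (g b))"])
    have sub: "cball 0 s' \<subseteq> ball (0 :: complex) 1" using \<sigma>(3) by auto
    show "uniform_limit (cball 0 s') (\<lambda>k. m (r k)) \<phi> sequentially" by (rule \<phi>(4)[OF compact_cball sub])
    show "continuous_on (cball 0 s') \<phi>"
      by (rule holomorphic_on_imp_continuous_on[OF holomorphic_on_subset[OF \<phi>(1) sub]])
    show "complex_of_real (\<sigma> (r k)) \<in> cball 0 s'" for k using \<sigma>(1,2) by simp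
    show "(\<lambda>k. complex_of_real (\<sigma> (r k))) \<longlonglongrightarrow> complex_of_real (cmod (g b))"
      using LIMSEQ_subseq_LIMSEQ[OF \<sigma>(4) \<phi>(2)] by (intro tendsto_of_real) (simp add: comp_def)
    show "complex_of_real (cmod (g b)) \<in> cball 0 s'" using s' by simp
  qed
  then have \<phi>b: "\<phi> (of_real (cmod (g b))) = g b"
    unfolding m\<sigma> using LIMSEQ_unique[OF _ tendsto_const] by blast
  have "\<exists>\<alpha>. (\<forall>z. cmod z < 1 \<longrightarrow> \<phi> z = \<alpha> * z) \<and> cmod \<alpha> = 1"
  proof (rule Schwarz_Lemma(3)[OF \<phi>(1) \<phi>0 _ _])
    show "(\<exists>z. cmod z < 1 \<and> z \<noteq> 0 \<and> cmod (\<phi> z) = cmod z) \<or> cmod (deriv \<phi> 0) = 1"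
      using \<phi>b s' \<sigma>(3) g(4) by (intro disjI1 exI[of _ "of_real (cmod (g b))"]) simp
    show "cmod (0 :: complex) < 1" by simp
  qed (use \<phi>lt in auto)
  then obtain \<alpha> where \<alpha>: "\<And>z. z \<in> ball 0 1 \<Longrightarrow> \<phi> z = \<alpha> * z" "cmod \<alpha> = 1" by auto
  have "(\<lambda>k. g (l (r k) \<zeta> $ j)) \<longlonglongrightarrow> \<alpha> * \<zeta>" if \<zeta>: "\<zeta> \<in> ball 0 1" for \<zeta> j
  proof -
    have "(\<lambda>k. (\<chi> j. g (l (r k) \<zeta> $ j)) $ j - m (r k) \<zeta>) \<longlonglongrightarrow> 0"
    proof (rule deviation_tendsto_0[where \<alpha> = \<alpha>])
      fix k i
      show "(\<lambda>\<zeta>. elem_sym i (\<chi> j. (\<chi> j. g (l (r k) \<zeta> $ j)) $ j - m (r k) \<zeta>)) holomorphic_on ball 0 1"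
        using elem_sym_compose_holomorphic[OF open_ball l(1,2) D(2,1) g(1) mh] by simp
    next
      fix K :: "complex set" assume K: "compact K" "K \<subseteq> ball 0 1"
      show "uniform_limit K (\<lambda>k. m (r k)) (\<lambda>\<zeta>. \<alpha> * \<zeta>) sequentially"
        using \<phi>(4)[OF K] by (rule uniform_limit_cong'[THEN iffD1, rotated -1]) (use \<alpha> K in auto)
    qed (use less_imp_le[OF g1] \<zeta> \<alpha> in \<open>auto simp: m_def\<close>)
    then have "(\<lambda>k. (g (l (r k) \<zeta> $ j) - m (r k) \<zeta>) + m (r k) \<zeta>) \<longlonglongrightarrow> 0 + \<phi> \<zeta>"
      by (intro tendsto_add \<phi>(3)[OF \<zeta>]) simp
    then show ?thesis using \<alpha>(1)[OF \<zeta>] by simp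
  qed
  with \<alpha>(2) \<phi>(2) show ?thesis by blast
qed

text \<open>The inverse map is a limit \<open>h\<close> of the means of the branches themselves.
  Near 0 all branches lie where \<open>g\<close> is injective, so they converge to a local inverse
  of \<open>g\<close>; the identity theorem propagates both inverse relations once \<open>h\<close>
  is known to stay in \<open>D\<close>.\<close>

lemma biholomorphic_disc_of_coalescing:
  fixes l :: "nat \<Rightarrow> complex \<Rightarrow> complex ^ 'n" and D :: "complex set"
  assumes D: "open D" "connected D" "bounded D" "a \<in> D"
    and g: "g holomorphic_on D" "g ` D \<subseteq> ball 0 1" "g a = 0" "deriv g a \<noteq> 0"
    and l: "\<And>k i. (\<lambda>\<zeta>. elem_sym i (l k \<zeta>)) holomorphic_on ball 0 1"
      "\<And>k \<zeta> j. \<zeta> \<in> ball 0 1 \<Longrightarrow> l k \<zeta> $ j \<in> D" "\<And>k j. l k 0 $ j = a"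
    and \<alpha>: "cmod \<alpha> = 1"
    and lim: "\<And>\<zeta> j. \<zeta> \<in> ball 0 1 \<Longrightarrow> (\<lambda>k. g (l k \<zeta> $ j)) \<longlonglongrightarrow> \<alpha> * \<zeta>"
  shows "biholomorphic D (ball 0 1)"
proof -
  let ?n = "CARD('n)"
  obtain M where M: "\<And>t. t \<in> D \<Longrightarrow> cmod t \<le> M"
    using D(3) unfolding bounded_iff by blast
  have comp: "(\<lambda>\<zeta>. elem_sym i (\<chi> j. l k \<zeta> $ j - c)) holomorphic_on ball 0 1" for i k c
    using elem_sym_compose_holomorphic[OF open_ball l(1,2) D(3,1) holomorphic_on_ident holomorphic_on_const]
    by simp
  define A where "A k \<zeta> = (\<Sum>j\<in>UNIV. l k \<zeta> $ j) / of_nat ?n" for k \<zeta>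
  have Ah: "A k holomorphic_on ball 0 1" for k
    unfolding A_def elem_sym_1[symmetric] by (intro holomorphic_intros l) auto
  have AM: "cmod (A k \<zeta>) \<le> M" if "\<zeta> \<in> ball 0 1" for k \<zeta>
  proof -
    have "cmod (\<Sum>j\<in>UNIV. l k \<zeta> $ j) \<le> (\<Sum>j\<in>(UNIV :: 'n set). M)"
      by (rule sum_norm_le) (rule M[OF l(2)[OF that]])
    then show ?thesis by (simp add: A_def norm_divide divide_le_eq mult.commute)
  qed
  obtain h r where h: "h holomorphic_on ball 0 1" "strict_mono (r :: nat \<Rightarrow> nat)"
    "\<And>x. x \<in> ball 0 1 \<Longrightarrow> (\<lambda>n. A (r n) x) \<longlonglongrightarrow> h x"
    by (rule Montel_bounded[of "ball 0 1" A M, OF open_ball Ah AM]) blast+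
  obtain r0 where r0: "r0 > 0" "ball a r0 \<subseteq> D" "inj_on g (ball a r0)"
    using has_complex_derivative_locally_injective[OF g(1) D(4,1) g(4)] by blast
  have gb: "g holomorphic_on ball a r0" using g(1) r0(2) by (rule holomorphic_on_subset)
  obtain gi where gi: "gi holomorphic_on g ` ball a r0" "\<And>z. z \<in> ball a r0 \<Longrightarrow> gi (g z) = z"
    using holomorphic_has_inverse[OF gb open_ball r0(3)] by metis
  have og: "open (g ` ball a r0)" by (rule open_mapping_thm3[OF gb open_ball r0(3)])
  have "0 \<in> g ` ball a r0" using g(3) r0(1) by (metis centre_in_ball imageI)
  then obtain d1 where d1: "d1 > 0" "ball 0 d1 \<subseteq> g ` ball a r0"
    using og open_contains_ball by blast
  obtain d2 where d2: "d2 > 0" "\<forall>l :: complex \<Rightarrow> complex ^ 'n.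
    (\<forall>k. (\<lambda>\<zeta>. elem_sym k (\<chi> j. l \<zeta> $ j - a)) holomorphic_on ball 0 1) \<longrightarrow>
    (\<forall>\<zeta>\<in>ball 0 1. \<forall>j. l \<zeta> $ j \<in> D) \<longrightarrow> (\<forall>j. l 0 $ j = a) \<longrightarrow>
    (\<forall>\<zeta>. cmod \<zeta> < d2 \<longrightarrow> (\<forall>j. dist (l \<zeta> $ j) a < r0))"
    using roots_near_uniform[OF D(3) r0(1), of a] by blast
  \<comment> \<open>For \<open>cmod \<zeta> < d\<close> every branch lies in
    \<open>ball a r0\<close>, and \<open>\<alpha> * \<zeta>\<close> lies in the image of that ball
    under \<open>g\<close>.\<close>
  define d where "d = min 1 (min d1 d2)"
  have d: "d > 0" "d \<le> 1" "d \<le> d1" "d \<le> d2" using d1 d2(1) by (auto simp: d_def)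
  have sub: "ball 0 d \<subseteq> ball (0 :: complex) 1" using d by auto
  have branch: "(\<lambda>k. l k \<zeta> $ j) \<longlonglongrightarrow> gi (\<alpha> * \<zeta>)" if \<zeta>: "\<zeta> \<in> ball 0 d" for \<zeta> j
  proof -
    have in_b: "l k \<zeta> $ j \<in> ball a r0" for k
      using d2(2)[rule_format, of "l k" \<zeta> j] comp l(2,3) \<zeta> d by (simp add: dist_commute)
    have "\<alpha> * \<zeta> \<in> g ` ball a r0" using d1(2) \<zeta> d \<alpha> by (auto simp: norm_mult)
    then have "(\<lambda>k. gi (g (l k \<zeta> $ j))) \<longlonglongrightarrow> gi (\<alpha> * \<zeta>)"
      by (intro continuous_on_tendsto_compose[OF holomorphic_on_imp_continuous_on[OF gi(1)] lim])
         (use \<zeta> sub in_b in auto)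
    then show ?thesis using gi(2)[OF in_b] by simp
  qed
  have hgi: "h \<zeta> = gi (\<alpha> * \<zeta>)" if \<zeta>: "\<zeta> \<in> ball 0 d" for \<zeta>
  proof -
    have "(\<lambda>k. A (r k) \<zeta>) \<longlonglongrightarrow> (\<Sum>j\<in>(UNIV :: 'n set). gi (\<alpha> * \<zeta>)) / of_nat ?n"
      unfolding A_def using LIMSEQ_subseq_LIMSEQ[OF branch[OF \<zeta>] h(2)]
      by (intro tendsto_intros) (auto simp: comp_def)
    then show ?thesis using LIMSEQ_unique[OF h(3)] \<zeta> sub by fastforce
  qed
  have hD: "h \<zeta> \<in> D" if \<zeta>: "\<zeta> \<in> ball 0 1" for \<zeta>
  proof (rule ccontr)
    define p where "p = h \<zeta>"
    assume "h \<zeta> \<notin> D"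
    then have p: "p \<notin> D" by (simp add: p_def)
    \<comment> \<open>As \<open>p\<close> is not in \<open>D\<close>, these products have no zeros.
      Their limit is the power of \<open>h - p\<close> near 0, hence everywhere; it is nonzero at 0,
      where \<open>h\<close> takes the value \<open>a\<close>, and zero at \<open>\<zeta>\<close>,
      against Hurwitz's theorem.\<close>
    define N where "N k \<zeta> = (\<Prod>j\<in>UNIV. l k \<zeta> $ j - p)" for k \<zeta>
    have Nh: "N k holomorphic_on ball 0 1" for k
      using comp[of ?n k p] by (simp add: elem_sym_card N_def[abs_def])
    have NM: "cmod (N k \<zeta>) \<le> (M + cmod p) ^ ?n" if "\<zeta> \<in> ball 0 1" for k \<zeta>
    proof -
      have "cmod (N k \<zeta>) \<le> (\<Prod>j\<in>(UNIV :: 'n set). M + cmod p)"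
        unfolding N_def prod_norm[symmetric]
      proof (intro prod_mono conjI norm_ge_zero)
        show "cmod (l k \<zeta> $ j - p) \<le> M + cmod p" for j
          using norm_triangle_ineq4[of "l k \<zeta> $ j" p] M[OF l(2)[OF that], of k j] by simp
      qed
      then show ?thesis by simp
    qed
    obtain N' r' where N': "N' holomorphic_on ball 0 1" "strict_mono (r' :: nat \<Rightarrow> nat)"
      "\<And>x. x \<in> ball 0 1 \<Longrightarrow> (\<lambda>n. N (r' n) x) \<longlonglongrightarrow> N' x"
      "\<And>K. compact K \<Longrightarrow> K \<subseteq> ball 0 1 \<Longrightarrow> uniform_limit K (\<lambda>n. N (r' n)) N' sequentially"
      by (rule Montel_bounded[of "ball 0 1" N, OF open_ball Nh NM]) blast+
    have N'eq: "N' z = (h z - p) ^ ?n" if z: "z \<in> ball 0 1" for z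
    proof (rule analytic_continuation_open[of "ball 0 d" "ball 0 1" N' "\<lambda>z. (h z - p) ^ ?n"])
      fix \<zeta> :: complex assume \<zeta>: "\<zeta> \<in> ball 0 d"
      have "(\<lambda>k. N (r' k) \<zeta>) \<longlonglongrightarrow> (\<Prod>j\<in>(UNIV :: 'n set). gi (\<alpha> * \<zeta>) - p)"
        unfolding N_def using LIMSEQ_subseq_LIMSEQ[OF branch[OF \<zeta>] N'(2)]
        by (intro tendsto_intros) (auto simp: comp_def)
      then show "N' \<zeta> = (h \<zeta> - p) ^ ?n"
        using LIMSEQ_unique[OF N'(3)] \<zeta> sub hgi[OF \<zeta>] by fastforce
    qed (use d sub N'(1) h(1) z in \<open>auto intro!: holomorphic_intros\<close>)
    have "gi 0 = a" using gi(2)[of a] r0(1) g(3) by simp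
    then have "h 0 = a" using hgi[of 0] d by simp
    then have N0: "N' 0 \<noteq> 0" using N'eq[of 0] p D(4) by auto
    have N\<zeta>: "N' \<zeta> = 0" using N'eq[OF \<zeta>] by (simp add: p_def)
    have "\<not> N' constant_on ball 0 1"
      using N0 N\<zeta> \<zeta> unfolding constant_on_def by (metis centre_in_ball zero_less_one)
    then have "N' \<zeta> \<noteq> 0"
    proof (rule Hurwitz_no_zeros[OF open_ball connected_ball Nh N'(1), rotated 1, OF _ _ \<zeta>])
      show "\<And>K. compact K \<Longrightarrow> K \<subseteq> ball 0 1 \<Longrightarrow> uniform_limit K (\<lambda>n. N (r' n)) N' sequentially" by (rule N'(4))
      show "N (r' n) z \<noteq> 0" if "z \<in> ball 0 1" for n z
        using l(2)[OF that] p by (auto simp: N_def)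
    qed
    then show False using N\<zeta> by simp
  qed
  have him: "h ` ball 0 1 \<subseteq> D" using hD by blast
  have gh: "g (h \<zeta>) = \<alpha> * \<zeta>" if \<zeta>: "\<zeta> \<in> ball 0 1" for \<zeta>
  proof (rule analytic_continuation_open[of "ball 0 d" "ball 0 1" "\<lambda>\<zeta>. g (h \<zeta>)" "\<lambda>\<zeta>. \<alpha> * \<zeta>"])
    show "(\<lambda>\<zeta>. g (h \<zeta>)) holomorphic_on ball 0 1"
      using holomorphic_on_compose_gen[OF h(1) g(1) him] by (simp add: comp_def)
    fix z :: complex assume z: "z \<in> ball 0 d"
    have "\<alpha> * z \<in> g ` ball a r0" using d1(2) z d \<alpha> by (auto simp: norm_mult)
    then obtain w where "w \<in> ball a r0" "\<alpha> * z = g w" by blast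
    then show "g (h z) = \<alpha> * z" using hgi[OF z] gi(2) by simp
  qed (use d sub \<zeta> in \<open>auto intro!: holomorphic_intros\<close>)
  have \<alpha>0: "\<alpha> \<noteq> 0" using \<alpha> by auto
  have gim: "(\<lambda>z. g z / \<alpha>) ` D \<subseteq> ball 0 1"
    using g(2) \<alpha> by (auto simp: norm_divide image_subset_iff)
  have gh': "(\<lambda>z. g z / \<alpha>) holomorphic_on D" by (intro holomorphic_intros g \<alpha>0)
  have hg: "h (g z / \<alpha>) = z" if z: "z \<in> D" for z
  proof -
    \<comment> \<open>On this neighbourhood of \<open>a\<close> the point
      \<open>g z / \<alpha>\<close> falls where \<open>h\<close> is given by the local
      inverse.\<close>
    define S where "S = ball a r0 \<inter> g -` ball 0 d"
    have oS: "open S"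
      unfolding S_def using holomorphic_on_imp_continuous_on[OF gb]
      by (rule continuous_open_preimage) auto
    show ?thesis
    proof (rule analytic_continuation_open[OF oS D(1) _ D(2), of "\<lambda>z. h (g z / \<alpha>)" "\<lambda>z. z"])
      have "a \<in> S" using r0(1) d(1) g(3) by (simp add: S_def)
      then show "S \<noteq> {}" by blast
      show "S \<subseteq> D" using r0(2) by (auto simp: S_def)
      show "(\<lambda>z. h (g z / \<alpha>)) holomorphic_on D"
        using holomorphic_on_compose_gen[OF gh' h(1) gim] by (simp add: comp_def)
      fix z assume "z \<in> S"
      then show "h (g z / \<alpha>) = z"
        using hgi[of "g z / \<alpha>"] gi(2)[of z] \<alpha> \<alpha>0 by (auto simp: S_def norm_divide)
    qed (use z in auto)
  qed
  show ?thesis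
    unfolding biholomorphic_def
    by (intro exI[of _ "\<lambda>z. g z / \<alpha>"] exI[of _ h] conjI gh' h(1) gim him) (use hg gh \<alpha>0 in auto)
qed

lemma biholomorphic_disc_of_caratheodory_eq_lempert:
  fixes D :: "complex set"
  defines "\<Omega> \<equiv> symmetric_power D :: (complex ^ 'n::{finite,linorder}) set"
  assumes eq: "\<forall>w\<in>\<Omega>. \<forall>z\<in>\<Omega>. caratheodory \<Omega> w z = lempert \<Omega> w z"
    and D: "open D" "connected D" "D \<noteq> {}" "bounded D"
  shows "biholomorphic D (ball 0 1)"
proof -
  obtain a b g where abg: "a \<in> D" "b \<in> D" and g: "g holomorphic_on D" "g ` D \<subseteq> ball 0 1" "g a = 0"
    "deriv g a \<noteq> 0" "g b \<noteq> 0"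
    and ext: "\<And>F. F holomorphic_on D \<Longrightarrow> F ` D \<subseteq> ball 0 1 \<Longrightarrow> F a = 0 \<Longrightarrow> cmod (F b) \<le> cmod (g b)"
    using extremal_with_nonzero_deriv[OF D] by blast
  define s where "s = cmod (g b)"
  have s: "0 \<le> s" "s < 1" using g(2) abg by (auto simp: s_def)
  \<comment> \<open>Levels decreasing to the extremal value \<open>s\<close> and at most the
    midpoint of \<open>s\<close> and 1, so that the parameters stay in a compact part of the
    disc.\<close>
  define t where "t k = s + (1 - s) / 2 * (1 / Suc k)" for k :: nat
  have t: "s < t k" "t k \<le> (1 + s) / 2" for k
  proof -
    have "(1 - s) / 2 * (1 / Suc k) \<le> (1 - s) / 2 * 1"
      using s by (intro mult_left_mono) auto
    then show "t k \<le> (1 + s) / 2" by (simp add: t_def field_simps)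
    show "s < t k" using s by (simp add: t_def)
  qed
  have t1: "(1 + s) / 2 < 1" using s by simp
  have "\<exists>(l :: complex \<Rightarrow> complex ^ 'n::{finite,linorder}) \<sigma>. (\<forall>k. (\<lambda>\<zeta>. elem_sym k (l \<zeta>)) holomorphic_on ball 0 1) \<and>
    (\<forall>\<zeta>\<in>ball 0 1. \<forall>j. l \<zeta> $ j \<in> D) \<and> (\<forall>j. l 0 $ j = a) \<and> (\<forall>j. l (of_real \<sigma>) $ j = b) \<and>
    0 \<le> \<sigma> \<and> \<sigma> < t k" for k
  proof (rule diagonal_lempert_disc[OF eq[unfolded \<Omega>_def] D(1) abg _ s(1) t(1)])
    show "t k < 1" using t(2)[of k] t1 by simp
  qed (auto simp: s_def intro: ext)
  then obtain l :: "nat \<Rightarrow> complex \<Rightarrow> complex ^ 'n::{finite,linorder}" and \<sigma> where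
    l: "\<And>k i. (\<lambda>\<zeta>. elem_sym i (l k \<zeta>)) holomorphic_on ball 0 1"
      "\<And>k \<zeta> j. \<zeta> \<in> ball 0 1 \<Longrightarrow> l k \<zeta> $ j \<in> D" "\<And>k j. l k 0 $ j = a"
      "\<And>k j. l k (of_real (\<sigma> k)) $ j = b"
    and \<sigma>: "\<And>k. 0 \<le> \<sigma> k" "\<And>k. \<sigma> k < t k" by metis
  have \<sigma>1: "\<sigma> k \<le> (1 + s) / 2" for k using \<sigma>(2)[of k] t(2)[of k] by simp
  \<comment> \<open>The mean of \<open>g\<close> over the branches sends 0 to 0 and
    \<open>\<sigma> k\<close> to \<open>g b\<close>, so Schwarz's lemma bounds
    \<open>\<sigma> k\<close> from below; with the upper bound \<open>t k\<close> this squeezes it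
    to \<open>s\<close>.\<close>
  have s_le: "s \<le> \<sigma> k" for k
  proof -
    let ?m = "\<lambda>\<zeta>. (\<Sum>j\<in>UNIV. g (l k \<zeta> $ j)) / of_nat CARD('n)"
    have \<sigma>k: "cmod (of_real (\<sigma> k)) < 1" using \<sigma>(1)[of k] \<sigma>1[of k] t1 by simp
    have "cmod (?m (of_real (\<sigma> k))) \<le> cmod (of_real (\<sigma> k))"
    proof (rule Schwarz_Lemma(1)[OF _ _ _ \<sigma>k])
      show "?m holomorphic_on ball 0 1"
        by (intro holomorphic_intros sum_compose_holomorphic[OF open_ball l(1,2) D(4,1) g(1)]) auto
      show "?m 0 = 0" by (simp add: l(3) g(3))
      show "cmod (?m z) < 1" if "cmod z < 1" for z
      proof -
        have "cmod (\<Sum>j\<in>UNIV. g (l k z $ j)) \<le> (\<Sum>j\<in>UNIV. cmod (g (l k z $ j)))" by (rule norm_sum)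
        also have "\<dots> < (\<Sum>j\<in>(UNIV :: 'n::{finite,linorder} set). 1)"
        proof (rule sum_strict_mono)
          show "cmod (g (l k z $ j)) < 1" for j
            using g(2) l(2)[of z k j] that by (force simp: image_subset_iff)
        qed auto
        finally show ?thesis by (simp add: norm_divide)
      qed
    qed
    then show ?thesis using \<sigma>(1)[of k] by (simp add: l(4) s_def)
  qed
  have "(\<lambda>k. s + (1 - s) / 2 * (1 / Suc k)) \<longlonglongrightarrow> s + (1 - s) / 2 * 0"
    by (intro tendsto_intros LIMSEQ_Suc lim_1_over_n)
  then have "t \<longlonglongrightarrow> s" by (simp add: t_def[abs_def])
  then have \<sigma>_lim: "\<sigma> \<longlonglongrightarrow> s"
    by (rule real_tendsto_sandwich[rotated 2, OF tendsto_const])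
       (use s_le \<sigma>(2) less_imp_le in \<open>auto intro!: always_eventually\<close>)
  obtain \<alpha> r where \<alpha>: "cmod \<alpha> = 1" "strict_mono (r :: nat \<Rightarrow> nat)"
    "\<And>\<zeta> j. \<zeta> \<in> ball 0 1 \<Longrightarrow> (\<lambda>k. g (l (r k) \<zeta> $ j)) \<longlonglongrightarrow> \<alpha> * \<zeta>"
    using extremal_branches_coalesce[OF D(1,4) g(1,2,3,5) l \<sigma>(1) \<sigma>1 t1 \<sigma>_lim[unfolded s_def]] by blast
  show ?thesis
    by (rule biholomorphic_disc_of_coalescing[OF D(1,2,4) abg(1) g(1-4) l(1-3) \<alpha>(1,3)])
qed

section \<open>The dimension is two\<close>

text \<open>As \<open>c\<close> varies, the symmetrisation of these roots traces a holomorphic disc: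
  only its last coordinate moves, and linearly. At \<open>c = 0\<close> the roots merge, which makes
  a separate case.\<close>

lemma nth_roots_vector_exists:
  "\<exists>x :: complex ^ 'n. (\<forall>j. x $ j ^ CARD('n) = c) \<and>
    (\<forall>k. elem_sym k x = (if k = 0 then 1 else if k = CARD('n) then - ((-1) ^ CARD('n) * c) else 0))"
proof -
  let ?n = "CARD('n)"
  have n0: "?n > 0" by simp
  define p :: "complex poly" where "p = monom 1 ?n - monom c 0"
  have "\<exists>x :: complex ^ 'n. (\<Prod>i\<in>UNIV. [:- (x $ i), 1:]) = p"
  proof (cases "c = 0")
    case True
    have "(\<Prod>i\<in>(UNIV :: 'n set). [:- ((0 :: complex ^ 'n) $ i), 1:]) = p"
      by (simp add: p_def True monom_altdef)
    then show ?thesis by blast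
  next
    case False
    have "card (UNIV :: 'n set) = card {z. z ^ ?n = c}"
      using card_nth_roots[OF False] by simp
    then obtain e where e: "bij_betw e (UNIV :: 'n set) {z. z ^ ?n = c}"
      using finite_same_card_bij[of "UNIV :: 'n set" "{z. z ^ ?n = c}"] finite_nth_roots[of ?n c] by auto
    let ?q = "\<Prod>i\<in>UNIV. [:- e i, 1:]"
    have deg: "degree ?q = ?n" by (subst degree_prod_sum_eq) auto
    have "?q = p"
    proof (rule poly_eqI_degree_lead_coeff[where A = "{z. z ^ ?n = c}" and n = ?n])
      fix z assume z: "z \<in> {z. z ^ ?n = c}"
      then obtain i where "z = e i" using e unfolding bij_betw_def by blast
      then have "poly ?q z = 0" by (auto simp: poly_prod intro: prod_zero)
      then show "poly ?q z = poly p z" using z by (simp add: p_def poly_monom)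
    next
      have "lead_coeff ?q = 1" by (simp add: lead_coeff_prod)
      then show "coeff ?q ?n = coeff p ?n" using n0 unfolding deg by (simp add: p_def)
      show "degree p \<le> ?n" by (rule degree_le) (simp add: p_def)
    qed (use deg card_nth_roots[OF False] in auto)
    then show ?thesis by (intro exI[of _ "\<chi> i. e i"]) simp
  qed
  then obtain x :: "complex ^ 'n" where x: "(\<Prod>i\<in>UNIV. [:- (x $ i), 1:]) = p" by blast
  have prod: "(\<Prod>i\<in>UNIV. t - x $ i) = t ^ ?n - c" for t
    using arg_cong[OF x, of "\<lambda>q. poly q t"] by (simp add: poly_prod p_def poly_monom)
  have "(\<Sum>k\<le>?n. monom ((-1) ^ k * elem_sym k x) (?n - k)) = p"
    unfolding poly_eq_poly_eq_iff[symmetric] fun_eq_iff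
    using prod by (simp add: vieta poly_sum poly_monom p_def)
  then have co: "coeff (\<Sum>k\<le>?n. monom ((-1) ^ k * elem_sym k x) (?n - k)) m = coeff p m" for m by simp
  have E: "(-1) ^ k * elem_sym k x = coeff p (?n - k)" if k: "k \<le> ?n" for k
  proof -
    have "coeff (\<Sum>k\<le>?n. monom ((-1) ^ k * elem_sym k x) (?n - k)) (?n - k)
        = (\<Sum>i\<le>?n. if i = k then (-1) ^ i * elem_sym i x else 0)"
      unfolding coeff_sum using k by (intro sum.cong) auto
    then show ?thesis using k co by simp
  qed
  have "elem_sym k x = (if k = 0 then 1 else if k = ?n then - ((-1) ^ ?n * c) else 0)" for k
  proof -
    consider "k > ?n" | "k = 0" | "0 < k" "k < ?n" | "k = ?n" by linarith
    then show ?thesis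
    proof cases
      case 4
      have "(-1) ^ ?n * elem_sym ?n x = - c" using E[of ?n] n0 by (simp add: p_def)
      then have "(-1) ^ ?n * ((-1) ^ ?n * elem_sym ?n x) = (-1) ^ ?n * - c" by simp
      then show ?thesis using 4 by (simp add: mult.assoc[symmetric] power_mult_distrib[symmetric])
    next
      case 3
      then have "?n \<noteq> ?n - k" "?n - k \<noteq> 0" by auto
      with E[of k] 3 show ?thesis by (simp add: p_def)
    qed (use E[of k] in \<open>auto simp: p_def elem_sym_gt_card\<close>)
  qed
  moreover have "x $ j ^ ?n = c" for j
  proof -
    have "(\<Prod>i\<in>UNIV. x $ j - x $ i) = 0" by (auto intro: prod_zero)
    then show ?thesis using prod[of "x $ j"] by simp
  qed
  ultimately show ?thesis by blast
qed

text \<open>The inequality of the arithmetic and geometric means for the squared deviations,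
  followed by \<open>sum_deviation_square\<close>.\<close>

lemma geometric_mean_deviation:
  fixes x :: "complex ^ 'n"
  assumes m: "m = (\<Sum>j\<in>UNIV. x $ j) / of_nat CARD('n)" and le: "\<And>j. cmod (x $ j) \<le> 1"
  shows "cmod (\<Prod>j\<in>UNIV. x $ j - m) powr (2 / CARD('n)) + (cmod m)\<^sup>2 \<le> 1"
proof -
  let ?n = "CARD('n)"
  let ?q = "cmod (\<Prod>j\<in>UNIV. x $ j - m)"
  have "?q powr (2 / ?n) = (?q\<^sup>2) powr (1 / ?n)"
    by (cases "?q = 0") (simp_all add: powr_powr flip: powr_numeral)
  also have "?q\<^sup>2 = (\<Prod>j\<in>UNIV. (cmod (x $ j - m))\<^sup>2)"
    by (simp add: prod_norm[symmetric] prod_power_distrib)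
  also have "\<dots> powr (1 / ?n) \<le> (\<Sum>j\<in>UNIV. (cmod (x $ j - m))\<^sup>2 / ?n)"
    by (rule arith_geom_mean) auto
  also have "\<dots> = (\<Sum>j\<in>UNIV. (cmod (x $ j - m))\<^sup>2) / ?n" by (simp add: sum_divide_distrib)
  also have "\<dots> \<le> ?n * (1 - (cmod m)\<^sup>2) / ?n"
    by (intro divide_right_mono sum_deviation_square[OF m le]) auto
  finally show ?thesis by simp
qed

lemma card_le_two_of_caratheodory_eq_lempert:
  fixes D :: "complex set"
  defines "\<Omega> \<equiv> symmetric_power D :: (complex ^ 'n::{finite,linorder}) set"
  assumes eq: "\<forall>w\<in>\<Omega>. \<forall>z\<in>\<Omega>. caratheodory \<Omega> w z = lempert \<Omega> w z"
    and D: "open D" "bounded D" and bih: "biholomorphic D (ball 0 1)"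
  shows "CARD('n::{finite,linorder}) \<le> 2"
proof (rule ccontr)
  let ?n = "CARD('n::{finite,linorder})"
  assume "\<not> ?n \<le> 2"
  then have n: "?n \<ge> 3" by simp
  obtain g h where g: "g holomorphic_on D" "g ` D \<subseteq> ball 0 1" and h: "h holomorphic_on ball 0 1" "h ` ball 0 1 \<subseteq> D"
    and gh: "\<And>w. w \<in> ball 0 1 \<Longrightarrow> g (h w) = w"
    using bih unfolding biholomorphic_def by blast
  \<comment> \<open>Its power with exponent 2/3 is \<open>1 / 10 ^ 4\<close>, well above the
    multiples of \<open>\<epsilon>\<close> lost in the estimates.\<close>
  define \<epsilon> :: real where "\<epsilon> = 1 / 10 ^ 6"
  have \<epsilon>: "0 < \<epsilon>" "\<epsilon> < 1" by (auto simp: \<epsilon>_def)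
  obtain X :: "complex \<Rightarrow> complex ^ 'n::{finite,linorder}" where X: "\<And>c j. X c $ j ^ ?n = c"
    "\<And>c k. elem_sym k (X c) = (if k = 0 then 1 else if k = ?n then - ((-1) ^ ?n * c) else 0)"
    using nth_roots_vector_exists[where 'n = 'n] by metis
  have X1: "X c $ j \<in> ball 0 1" if "c \<in> ball 0 1" for c j
  proof -
    have "cmod (X c $ j) ^ ?n = cmod c" by (metis X(1) norm_power)
    then have "cmod (X c $ j) ^ ?n < 1 ^ ?n" using that by simp
    then have "cmod (X c $ j) < 1" by (rule power_less_imp_less_base) simp
    then show ?thesis by simp
  qed
  have Xhol: "(\<lambda>\<zeta>. elem_sym k (X \<zeta>)) holomorphic_on ball 0 1" for k
    unfolding X(2) by (cases "k = 0"; cases "k = ?n") (auto intro!: holomorphic_intros)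
  \<comment> \<open>This carries the root vectors into \<open>D\<close>; at 0 all entries are
    \<open>h 0\<close>, so the disc \<open>?K\<close> below starts on the diagonal.\<close>
  define \<kappa> where "\<kappa> \<zeta> = (\<chi> j. h (X \<zeta> $ j))" for \<zeta>
  have \<kappa>hol: "(\<lambda>\<zeta>. elem_sym k (\<kappa> \<zeta>)) holomorphic_on ball 0 1" for k
    using elem_sym_compose_holomorphic[OF open_ball Xhol X1 bounded_ball open_ball h(1) holomorphic_on_const, of k 0]
    by (simp add: \<kappa>_def)
  let ?K = "\<lambda>\<zeta>. symmetrization (\<kappa> \<zeta>)"
  let ?d = "\<lambda>\<zeta>. symmetrization (\<chi> i. h \<zeta>) :: complex ^ 'n::{finite,linorder}"
  have K: "holo_disc ?K (ball 0 1)" "?K ` ball 0 1 \<subseteq> \<Omega>"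
    using holo_disc_symmetrization[OF \<kappa>hol] X1 h(2)
    by (auto simp: \<Omega>_def symmetric_power_def \<kappa>_def image_subset_iff)
  have d: "holo_disc ?d (ball 0 1)" "?d ` ball 0 1 \<subseteq> \<Omega>"
    using holo_disc_symmetrization_diag[OF h(1)] h(2)
    by (auto simp: \<Omega>_def symmetric_power_def image_subset_iff)
  \<comment> \<open>A competitor vanishing at \<open>?K (of_real \<epsilon>)\<close> has modulus at
    most \<open>\<epsilon>\<close> at \<open>?K 0\<close>, which is \<open>?d 0\<close>; moving
    along the diagonal to \<open>?d (1 / 2)\<close> adds at most \<open>1 / 2\<close>. The second
    \<open>\<epsilon>\<close> is the room between \<open>s\<close> and \<open>s'\<close>.\<close>
  have "\<exists>f \<sigma>. holo_disc f (ball 0 1) \<and> f ` ball 0 1 \<subseteq> \<Omega> \<and> f 0 = ?K (of_real \<epsilon>) \<and> f (of_real \<sigma>) = ?d (1 / 2)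
    \<and> 0 \<le> \<sigma> \<and> \<sigma> < 1 / 2 + 2 * \<epsilon>"
  proof (rule lempert_disc_exists[where s = "1 / 2 + \<epsilon>"])
    have "?K (of_real \<epsilon>) \<in> \<Omega>" by (rule subsetD[OF K(2)], rule imageI) (use \<epsilon> in simp)
    moreover have "?d (1 / 2) \<in> \<Omega>" by (rule subsetD[OF d(2)], rule imageI) simp
    ultimately show "caratheodory \<Omega> (?K (of_real \<epsilon>)) (?d (1 / 2)) = lempert \<Omega> (?K (of_real \<epsilon>)) (?d (1 / 2))"
      using eq by blast
    fix F assume F: "holo_scalar F \<Omega>" "F ` \<Omega> \<subseteq> ball 0 1" "F (?K (of_real \<epsilon>)) = 0"
    have F1: "cmod (F z) \<le> 1" if "z \<in> \<Omega>" for z using F(2) that by (force simp: image_subset_iff)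
    have "\<bar>cmod (F (?K (of_real \<epsilon>))) - cmod (F (?K 0))\<bar>
        \<le> cmod (of_real \<epsilon>) * (1 - cmod (F (?K (of_real \<epsilon>))) * cmod (F (?K 0)))"
    proof (rule schwarz_pick_modulus[of "\<lambda>\<zeta>. F (?K \<zeta>)"])
      show "(\<lambda>\<zeta>. F (?K \<zeta>)) holomorphic_on ball 0 1"
        by (rule holo_scalar_compose_holo_disc[OF F(1) K(1) open_ball K(2)])
      show "cmod (F (?K z)) \<le> 1" if "cmod z < 1" for z
        by (rule F1, rule subsetD[OF K(2)], rule imageI) (use that in simp)
    qed (use \<epsilon> in simp)
    then have K0: "cmod (F (?K 0)) \<le> \<epsilon>" using F(3) \<epsilon> by simp
    have "X 0 $ j = 0" for j using X(1)[of 0 j] by simp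
    then have "\<kappa> 0 = (\<chi> i. h 0)" by (simp add: \<kappa>_def)
    then have d0: "cmod (F (?d 0)) \<le> \<epsilon>" using K0 by simp
    have "\<bar>cmod (F (?d (1 / 2))) - cmod (F (?d 0))\<bar>
        \<le> cmod (1 / 2) * (1 - cmod (F (?d (1 / 2))) * cmod (F (?d 0)))"
    proof (rule schwarz_pick_modulus[of "\<lambda>\<zeta>. F (?d \<zeta>)"])
      show "(\<lambda>\<zeta>. F (?d \<zeta>)) holomorphic_on ball 0 1"
        by (rule holo_scalar_compose_holo_disc[OF F(1) d(1) open_ball d(2)])
      show "cmod (F (?d z)) \<le> 1" if "cmod z < 1" for z
        by (rule F1, rule subsetD[OF d(2)], rule imageI) (use that in simp)
    qed simp
    also have "\<dots> \<le> 1 / 2 * 1" by (simp add: norm_divide)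
    finally show "cmod (F (?d (1 / 2))) \<le> 1 / 2 + \<epsilon>" using d0 by linarith
  qed (auto simp: \<epsilon>_def)
  then obtain f \<sigma> where f: "holo_disc f (ball 0 1)" "f ` ball 0 1 \<subseteq> \<Omega>" "f 0 = ?K (of_real \<epsilon>)"
    "f (of_real \<sigma>) = ?d (1 / 2)" and \<sigma>: "0 \<le> \<sigma>" "\<sigma> < 1 / 2 + 2 * \<epsilon>" by blast
  have \<sigma>1: "\<sigma> < 1" using \<sigma>(2) by (simp add: \<epsilon>_def)
  obtain l :: "complex \<Rightarrow> complex ^ 'n::{finite,linorder}" where l: "\<And>\<zeta>. \<zeta> \<in> ball 0 1 \<Longrightarrow> symmetrization (l \<zeta>) = f \<zeta>"
    "\<And>\<zeta> i. \<zeta> \<in> ball 0 1 \<Longrightarrow> l \<zeta> $ i \<in> D" "\<And>k. (\<lambda>\<zeta>. elem_sym k (l \<zeta>)) holomorphic_on ball 0 1"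
    using symmetric_power_disc_lift[OF f(1) f(2)[unfolded \<Omega>_def]] by blast
  define \<phi> where "\<phi> \<zeta> = (\<Sum>j\<in>UNIV. g (l \<zeta> $ j)) / of_nat ?n" for \<zeta>
  define Q where "Q \<zeta> = (\<Prod>j\<in>UNIV. g (l \<zeta> $ j) - \<phi> \<zeta>)" for \<zeta>
  have \<phi>hol: "\<phi> holomorphic_on ball 0 1"
    unfolding \<phi>_def by (intro holomorphic_intros sum_compose_holomorphic[OF open_ball l(3,2) D(2,1) g(1)]) auto
  have Qhol: "Q holomorphic_on ball 0 1"
    using elem_sym_compose_holomorphic[OF open_ball l(3,2) D(2,1) g(1) \<phi>hol, of ?n]
    by (simp add: elem_sym_card Q_def[abs_def])
  have gm: "cmod (Q \<zeta>) powr (2 / ?n) + (cmod (\<phi> \<zeta>))\<^sup>2 \<le> 1" if "\<zeta> \<in> ball 0 1" for \<zeta>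
  proof -
    have "cmod (g (l \<zeta> $ j)) \<le> 1" for j using g(2) l(2)[OF that, of j] by (force simp: image_subset_iff)
    then show ?thesis
      using geometric_mean_deviation[of "\<phi> \<zeta>" "\<chi> j. g (l \<zeta> $ j)"] by (simp add: \<phi>_def Q_def)
  qed
  \<comment> \<open>The two vectors agree only up to order, so just symmetric expressions are
    transferred: the mean, which is 0, and the product of the deviations.\<close>
  have e0: "elem_sym k (l 0) = elem_sym k (\<kappa> (of_real \<epsilon>))" for k
    using l(1)[of 0] f(3) by (simp add: symmetrization_eq_iff)
  have g\<kappa>: "g (\<kappa> (of_real \<epsilon>) $ j) = X (of_real \<epsilon>) $ j" for j
    unfolding \<kappa>_def using gh X1[of "of_real \<epsilon>" j] \<epsilon> by simp
  have "(\<Sum>j\<in>UNIV. g (l 0 $ j)) = elem_sym 1 (X (of_real \<epsilon>))"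
    unfolding sum_eq_of_elem_sym_eq[of "l 0" "\<kappa> (of_real \<epsilon>)" g, OF e0] elem_sym_1 g\<kappa> ..
  then have \<phi>0: "\<phi> 0 = 0" using n by (simp add: \<phi>_def X(2))
  have "Q 0 = elem_sym ?n (X (of_real \<epsilon>))"
    unfolding Q_def \<phi>0 elem_sym_card prod_eq_of_elem_sym_eq[of "l 0" "\<kappa> (of_real \<epsilon>)" "\<lambda>t. g t - 0", OF e0] g\<kappa>
    by simp
  then have Q0: "cmod (Q 0) = \<epsilon>" using n \<epsilon> by (simp add: X(2) norm_mult norm_power)
  have "l (of_real \<sigma>) $ j = h (1 / 2)" for j
    by (rule eq_const_of_symmetrization_eq) (use l(1)[of "of_real \<sigma>"] f(4) \<sigma>(1) \<sigma>1 in simp)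
  then have \<phi>\<sigma>: "\<phi> (of_real \<sigma>) = 1 / 2" using gh[of "1 / 2"] by (simp add: \<phi>_def)
  obtain \<chi>' where \<chi>: "\<chi>' holomorphic_on ball 0 1" "\<And>z. cmod z < 1 \<Longrightarrow> \<phi> z = z * \<chi>' z"
    using Schwarz3[OF \<phi>hol \<phi>0] by metis
  have \<phi>1: "cmod (\<phi> z) \<le> 1" if "cmod z < 1" for z
  proof -
    have "(cmod (\<phi> z))\<^sup>2 \<le> cmod (Q z) powr (2 / ?n) + (cmod (\<phi> z))\<^sup>2" by simp
    also have "\<dots> \<le> 1" by (rule gm) (use that in simp)
    finally have "(cmod (\<phi> z))\<^sup>2 \<le> 1" .
    then show ?thesis by (simp add: abs_square_le_1)
  qed
  have \<chi>1: "cmod (\<chi>' z) \<le> 1" if "cmod z < 1" for z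
    by (rule norm_le_one_of_power_mult[OF \<chi>(1) _ that, of 1]) (use \<phi>1 \<chi>(2) in simp)
  let ?S = "cmod (Q 0) powr (2 / ?n) + (cmod (\<chi>' 0))\<^sup>2"
  \<comment> \<open>On the circle of radius \<open>r\<close> the bound \<open>gm\<close> is divided
    by \<open>r\<^sup>2\<close>, then carried to 0 by the maximum principle. Dividing
    \<open>\<phi>\<close> by its variable first matters because \<open>\<phi> 0\<close>
    vanishes.\<close>
  have S: "?S * r\<^sup>2 \<le> 1" if r: "0 < r" "r < 1" for r
  proof -
    have "?S \<le> 1 / r\<^sup>2"
    proof (rule modulus_power_sum_max_principle[OF Qhol \<chi>(1) r])
      fix z assume z: "cmod z = r"
      then have z1: "cmod z < 1" using r by simp
      have "cmod (Q z) powr (2 / ?n) * r\<^sup>2 \<le> cmod (Q z) powr (2 / ?n) * 1"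
        using r by (intro mult_left_mono power_le_one) auto
      moreover have "(cmod (\<phi> z))\<^sup>2 = (cmod (\<chi>' z))\<^sup>2 * r\<^sup>2"
        using \<chi>(2)[OF z1] z by (simp add: norm_mult power_mult_distrib)
      ultimately have "(cmod (Q z) powr (2 / ?n) + (cmod (\<chi>' z))\<^sup>2) * r\<^sup>2 \<le> 1"
        using gm[of z] z1 by (simp add: distrib_right)
      then show "cmod (Q z) powr (2 / ?n) + (cmod (\<chi>' z))\<^sup>2 \<le> 1 / r\<^sup>2"
        using r by (simp add: pos_le_divide_eq)
    qed simp
    then show ?thesis using r by (simp add: pos_le_divide_eq)
  qed
  have "((\<lambda>r. ?S * r\<^sup>2) \<longlongrightarrow> ?S * 1\<^sup>2) (at_left (1::real))" by (intro tendsto_intros)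
  then have "?S * 1\<^sup>2 \<le> 1"
  proof (rule tendsto_upperbound)
    show "\<forall>\<^sub>F r in at_left 1. ?S * r\<^sup>2 \<le> 1"
      by (rule eventually_at_leftI[of 0]) (use S in auto)
  qed simp
  \<comment> \<open>Here \<open>?n \<ge> 3\<close> enters: the exponent is at most 2/3 and
    \<open>\<epsilon> < 1\<close>. With two branches the exponent would be 1 and the gain only
    \<open>\<epsilon>\<close>.\<close>
  moreover have "1 / 10 ^ 4 \<le> \<epsilon> powr (2 / ?n)"
  proof -
    have "\<epsilon> = (1 / 100) powr 3" by (simp add: \<epsilon>_def power_divide)
    then have "\<epsilon> powr (2 / 3) = ((1 / 100) powr 3) powr (2 / 3)" by simp
    also have "\<dots> = (1 / 100) powr 2" by (simp only: powr_powr) simp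
    finally have "1 / 10 ^ 4 = \<epsilon> powr (2 / 3)" by (simp add: power_divide)
    also have "\<dots> \<le> \<epsilon> powr (2 / ?n)"
    proof (rule powr_mono')
      show "2 / real ?n \<le> 2 / 3" using n by (intro divide_left_mono) auto
    qed (use \<epsilon> in auto)
    finally show ?thesis .
  qed
  ultimately have "(cmod (\<chi>' 0))\<^sup>2 \<le> 1 - 1 / 10 ^ 4" by (simp add: Q0)
  also have "\<dots> \<le> (1 - 1 / 20000 :: real)\<^sup>2" by (simp add: power2_eq_square)
  finally have up: "cmod (\<chi>' 0) \<le> 1 - 1 / 20000" by (rule power2_le_imp_le) simp
  \<comment> \<open>Since \<open>\<sigma> * u = 1 / 2\<close> with
    \<open>\<sigma> < 1 / 2 + 2 * \<epsilon>\<close>, \<open>u\<close> exceeds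
    \<open>1 - 4 * \<epsilon>\<close>, and the comparison of moduli at 0 and \<open>\<sigma>\<close>
    puts \<open>v\<close> above \<open>1 - 12 * \<epsilon>\<close>. This contradicts
    \<open>up\<close>, as \<open>12 * \<epsilon>\<close> is below \<open>1 / 20000\<close>.\<close>
  define u v where "u = cmod (\<chi>' (of_real \<sigma>))" and "v = cmod (\<chi>' 0)"
  have \<sigma>c: "cmod (of_real \<sigma>) < 1" using \<sigma>(1) \<sigma>1 by simp
  have u\<sigma>: "\<sigma> * u = 1 / 2"
  proof -
    have "cmod (1 / 2) = cmod (of_real \<sigma> * \<chi>' (of_real \<sigma>))" unfolding \<chi>(2)[OF \<sigma>c, symmetric] \<phi>\<sigma> ..
    then show ?thesis using \<sigma>(1) by (simp add: u_def norm_mult norm_divide)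
  qed
  have "\<bar>u - v\<bar> \<le> \<sigma> * (1 - u * v)"
    using schwarz_pick_modulus[OF \<chi>(1) \<chi>1 \<sigma>c] \<sigma>(1) by (simp add: u_def v_def)
  then have "u - v \<le> \<sigma> - \<sigma> * u * v" by (simp add: algebra_simps abs_le_iff)
  then have low: "2 * u - 2 * \<sigma> \<le> v" unfolding u\<sigma> by simp
  have "\<sigma> * u < (1 / 2 + 2 * \<epsilon>) * u"
    using \<sigma>(2) u\<sigma> by (intro mult_strict_right_mono) (auto simp: u_def)
  then have "1 / 2 < (1 / 2 + 2 * \<epsilon>) * u" using u\<sigma> by simp
  then have "1 - 4 * \<epsilon> < u" by (simp add: \<epsilon>_def)
  with low up \<sigma>(2) show False by (simp add: v_def \<epsilon>_def)
qed

theorem theorem12: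
  fixes D :: "complex set"
  assumes "is_domain D" and "bounded D" and "hyperconvex D"
    and "CARD('n::{finite,linorder}) \<ge> 2"
    and "\<forall>w\<in>symmetric_power D. \<forall>z\<in>symmetric_power D.
           caratheodory (symmetric_power D) w z
             = lempert (symmetric_power D :: (complex ^ ('n::{finite,linorder})) set) w z"
  shows "biholomorphic D (ball 0 1) \<and> CARD('n) = 2"
proof -
  have D: "open D" "connected D" "D \<noteq> {}" using assms(1) by (auto simp: is_domain_def)
  have "biholomorphic D (ball 0 1)"
    by (rule biholomorphic_disc_of_caratheodory_eq_lempert[OF assms(5) D assms(2)])
  moreover from card_le_two_of_caratheodory_eq_lempert[OF assms(5) D(1) assms(2) this]
  have "CARD('n) \<le> 2" .
  ultimately show ?thesis using assms(4) by simp
qed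

end
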